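(* Let $f^0$ be a curvature surface on $D=\{(x,y)\in\mathbb{R}^2:x>0\}$ with frame field $F^0=[\phi,X^0_\alpha,X^0_\beta,\xi]$, and let $\boldsymbol{u}(y)=(1+y^2)^{-1/2}(yX^0_\beta-\phi)(x,y)$ (a unit vector depending only on $y$) and $\tilde{\boldsymbol{u}}(x)=(B_2^2+C_2^2)^{-1/2}(x)(-B_2X^0_\alpha+C_2\xi)(x,y)$ (a unit vector depending only on $x$). There is an orthonormal frame $[\boldsymbol{b}^\infty,\boldsymbol{c}^\infty,\tilde{\boldsymbol{b}}^\infty,\tilde{\boldsymbol{c}}^\infty]$ of $\mathbb{R}^4$ consisting of constant vectors such that: (1) The vector $\boldsymbol{u}(y)$ moves on the unit circle in the plane spanned by $\tilde{\boldsymbol{b}}^\infty$ and $\tilde{\boldsymbol{c}}^\infty$. Let $\boldsymbol{v}_1(y)$ be the unit vector-valued function of $y$ determined by $\frac{d\boldsymbol{u}}{dy}(y)=\frac{y^2}{1+y^2}\boldsymbol{v}_1(y)$. Then, as $y\to\infty$, $\boldsymbol{u}(y)$ (resp. $\boldsymbol{v}_1(y)$) uniformly converges to the circle $\tilde{\boldsymbol{b}}(y):=\cos y\,\tilde{\boldsymbol{b}}^\infty+\sin y\,\tilde{\boldsymbol{c}}^\infty$ (resp. $\tilde{\boldsymbol{c}}(y):=-\sin y\,\tilde{\boldsymbol{b}}^\infty+\cos y\,\tilde{\boldsymbol{c}}^\infty$). (2) The vector $\tilde{\boldsymbol{u}}(x)$ moves on the unit circle in the plane spanned by $\boldsymbol{b}^\infty$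 and $\boldsymbol{c}^\infty$. Let $\tilde{\boldsymbol{v}}_1(x)$ be the unit vector determined by $\frac{d}{du}\big(\tilde{\boldsymbol{u}}(e^{-u})\big)=-T(u)\,\tilde{\boldsymbol{v}}_1(e^{-u})$ with $T(u)>0$. Then, as $u\to\infty$, $\tilde{\boldsymbol{u}}(e^{-u})$ (resp. $\tilde{\boldsymbol{v}}_1(e^{-u})$) uniformly converges to the circle $\cos\frac{\sqrt5u}{2}\boldsymbol{b}^\infty-\sin\frac{\sqrt5u}{2}\boldsymbol{c}^\infty$ (resp. $\sin\frac{\sqrt5u}{2}\boldsymbol{b}^\infty+\cos\frac{\sqrt5u}{2}\boldsymbol{c}^\infty$).
   Context: $X_0(x)=\frac52+\sum_{k\ge1}a_kx^{2k}$ (analytic on $\mathbb{R}$), $a_1=1$, $2(k+1)(4k^2+\frac54)a_{k+1}+(2k-1)a_k=0$ $(k\ge1)$. $h(x,y)=2X_0-xX_0'+y^2\frac{X_0'}{x}+\sqrt5$ (positive). $B_2(x)=-\frac12\frac{X_0'}{x}-\sqrt5$, $C_2(x)=X_0''-\frac{X_0'}{x}$. On $D$ put $a_1=\frac{2y}{xh}(X_0+\frac{\sqrt5}{2})$, $b_1=-\frac{1}{xh}(X_0+\frac{\sqrt5}{2}+\sqrt5(x^2-y^2))$, $c_1=-\frac{2}{xh}(X_0+\frac{\sqrt5}{2})$, $a_2=-\frac1h(2X_0+\sqrt5-(x^2+y^2)\frac{X_0'}{x})$, $b_2=-\frac{2y}{h}(\frac{X_0'}{2x}+\sqrt5)$,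 $c_2=\frac{2y}{h}(X_0''-\frac{X_0'}{x})$. The frame field is an analytic orthonormal frame field $F^0=[\phi,X^0_\alpha,X^0_\beta,\xi]$ of $\mathbb{R}^4$ on $D$ satisfying $\phi_x=-a_1X^0_\alpha$, $\xi_x=b_1X^0_\alpha$, $(X^0_\beta)_x=c_1X^0_\alpha$, $(X^0_\alpha)_x=a_1\phi-b_1\xi-c_1X^0_\beta$, $\phi_y=-a_2X^0_\beta$, $\xi_y=b_2X^0_\beta$, $(X^0_\alpha)_y=c_2X^0_\beta$, $(X^0_\beta)_y=a_2\phi-b_2\xi-c_2X^0_\alpha$ (it exists and is unique up to left multiplication by a constant orthogonal matrix). The curvature surface $f^0:D\to\mathbb{R}^4$ determined by $F^0$ is the analytic map, unique up to translation, with $df^0=\frac{x^2-y^2}{xh}X^0_\alpha dx+\frac{2y}{h}X^0_\beta dy$. "$M(u)$ uniformly converges to $N(u)$ as $u\to\infty$" means: for every $\varepsilon>0$ there is $U$ with $\|M(u)-N(u)\|<\varepsilon$ for all $u>U$. The function $\boldsymbol{v}_1$ is taken continuous (this determines it at $y=0$). *)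

theory Defs
  imports "HOL-Analysis.Analysis"
begin

text \<open>
  The recurrence \<open>2(k+1)(4k\<^sup>2 + 5/4) a(k+1) + (2k-1) a(k) = 0\<close> for \<open>k \<ge> 1\<close>,
  solved for \<open>a(k+1)\<close> and read with \<open>k = Suc n\<close>.
\<close>

fun X0_coeff :: "nat \<Rightarrow> real" where
  "X0_coeff 0 = 5 / 2"
| "X0_coeff (Suc 0) = 1"
| "X0_coeff (Suc (Suc n)) =
     - ((2 * real (Suc n) - 1) / (2 * (real (Suc n) + 1) * (4 * (real (Suc n))\<^sup>2 + 5 / 4)))
       * X0_coeff (Suc n)"

definition X0 :: "real \<Rightarrow> real" where
  "X0 x = (\<Sum>k. X0_coeff k * x ^ (2 * k))"

definition dX0 :: "real \<Rightarrow> real" where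
  "dX0 = deriv X0"

definition ddX0 :: "real \<Rightarrow> real" where
  "ddX0 = deriv dX0"

definition h_fun :: "real \<Rightarrow> real \<Rightarrow> real" where
  "h_fun x y = 2 * X0 x - x * dX0 x + y\<^sup>2 * (dX0 x / x) + sqrt 5"

definition B2 :: "real \<Rightarrow> real" where
  "B2 x = - (1 / 2) * (dX0 x / x) - sqrt 5"

definition C2 :: "real \<Rightarrow> real" where
  "C2 x = ddX0 x - dX0 x / x"

definition half_plane :: "(real \<times> real) set" where
  "half_plane = {(x, y). x > 0}"

text \<open>
  Coefficients of the structure equations of the frame; \<open>coef_a1\<close> is not to be confused
  with the power series coefficient \<open>X0_coeff 1\<close>.
\<close>

definition coef_a1 :: "real \<Rightarrow> real \<Rightarrow> real" where
  "coef_a1 x y = 2 * y / (x * h_fun x y) * (X0 x + sqrt 5 / 2)"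

definition coef_b1 :: "real \<Rightarrow> real \<Rightarrow> real" where
  "coef_b1 x y = - (1 / (x * h_fun x y)) * (X0 x + sqrt 5 / 2 + sqrt 5 * (x\<^sup>2 - y\<^sup>2))"

definition coef_c1 :: "real \<Rightarrow> real \<Rightarrow> real" where
  "coef_c1 x y = - (2 / (x * h_fun x y)) * (X0 x + sqrt 5 / 2)"

definition coef_a2 :: "real \<Rightarrow> real \<Rightarrow> real" where
  "coef_a2 x y = - (1 / h_fun x y) * (2 * X0 x + sqrt 5 - (x\<^sup>2 + y\<^sup>2) * (dX0 x / x))"

definition coef_b2 :: "real \<Rightarrow> real \<Rightarrow> real" where
  "coef_b2 x y = - (2 * y / h_fun x y) * (dX0 x / (2 * x) + sqrt 5)"

definition coef_c2 :: "real \<Rightarrow> real \<Rightarrow> real" where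
  "coef_c2 x y = 2 * y / h_fun x y * (ddX0 x - dX0 x / x)"

text \<open>Real analyticity in two variables: local expansion into a double power series.\<close>

definition real_analytic2_on ::
    "(real \<Rightarrow> real \<Rightarrow> 'a::real_normed_vector) \<Rightarrow> (real \<times> real) set \<Rightarrow> bool" where
  "real_analytic2_on g S \<longleftrightarrow>
     (\<forall>(x0, y0) \<in> S. \<exists>c r. r > 0 \<and>
        (\<forall>x y. \<bar>x - x0\<bar> < r \<and> \<bar>y - y0\<bar> < r \<longrightarrow>
           ((\<lambda>(i, j). ((x - x0) ^ i * (y - y0) ^ j) *\<^sub>R c i j) has_sum g x y)
             (UNIV :: (nat \<times> nat) set)))"

definition orthonormal_frame :: "(real ^ 4) list \<Rightarrow> bool" where
  "orthonormal_frame F \<longleftrightarrow>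
     length F = 4 \<and> (\<forall>i<4. \<forall>j<4. F ! i \<bullet> F ! j = (if i = j then 1 else 0))"

definition frame_field ::
    "(real \<Rightarrow> real \<Rightarrow> real ^ 4) \<Rightarrow> (real \<Rightarrow> real \<Rightarrow> real ^ 4) \<Rightarrow>
     (real \<Rightarrow> real \<Rightarrow> real ^ 4) \<Rightarrow> (real \<Rightarrow> real \<Rightarrow> real ^ 4) \<Rightarrow> bool" where
  "frame_field \<phi> X\<alpha> X\<beta> \<xi> \<longleftrightarrow>
     real_analytic2_on \<phi> half_plane \<and> real_analytic2_on X\<alpha> half_plane \<and>
     real_analytic2_on X\<beta> half_plane \<and> real_analytic2_on \<xi> half_plane \<and>
     (\<forall>(x, y) \<in> half_plane.
        orthonormal_frame [\<phi> x y, X\<alpha> x y, X\<beta> x y, \<xi> x y] \<and>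
        ((\<lambda>s. \<phi> s y) has_vector_derivative - (coef_a1 x y *\<^sub>R X\<alpha> x y)) (at x) \<and>
        ((\<lambda>s. \<xi> s y) has_vector_derivative coef_b1 x y *\<^sub>R X\<alpha> x y) (at x) \<and>
        ((\<lambda>s. X\<beta> s y) has_vector_derivative coef_c1 x y *\<^sub>R X\<alpha> x y) (at x) \<and>
        ((\<lambda>s. X\<alpha> s y) has_vector_derivative
           coef_a1 x y *\<^sub>R \<phi> x y - coef_b1 x y *\<^sub>R \<xi> x y - coef_c1 x y *\<^sub>R X\<beta> x y) (at x) \<and>
        ((\<lambda>t. \<phi> x t) has_vector_derivative - (coef_a2 x y *\<^sub>R X\<beta> x y)) (at y) \<and>
        ((\<lambda>t. \<xi> x t) has_vector_derivative coef_b2 x y *\<^sub>R X\<beta> x y) (at y) \<and>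
        ((\<lambda>t. X\<alpha> x t) has_vector_derivative coef_c2 x y *\<^sub>R X\<beta> x y) (at y) \<and>
        ((\<lambda>t. X\<beta> x t) has_vector_derivative
           coef_a2 x y *\<^sub>R \<phi> x y - coef_b2 x y *\<^sub>R \<xi> x y - coef_c2 x y *\<^sub>R X\<alpha> x y) (at y))"

definition curvature_surface ::
    "(real \<Rightarrow> real \<Rightarrow> real ^ 4) \<Rightarrow> (real \<Rightarrow> real \<Rightarrow> real ^ 4) \<Rightarrow> (real \<Rightarrow> real \<Rightarrow> real ^ 4) \<Rightarrow>
     (real \<Rightarrow> real \<Rightarrow> real ^ 4) \<Rightarrow> (real \<Rightarrow> real \<Rightarrow> real ^ 4) \<Rightarrow> bool" where
  "curvature_surface f \<phi> X\<alpha> X\<beta> \<xi> \<longleftrightarrow>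
     frame_field \<phi> X\<alpha> X\<beta> \<xi> \<and>
     real_analytic2_on f half_plane \<and>
     (\<forall>(x, y) \<in> half_plane.
        ((\<lambda>(s, t). f s t) has_derivative
           (\<lambda>(dx, dy). ((x\<^sup>2 - y\<^sup>2) / (x * h_fun x y) * dx) *\<^sub>R X\<alpha> x y
                      + (2 * y / h_fun x y * dy) *\<^sub>R X\<beta> x y)) (at (x, y)))"

definition unit_circle :: "real ^ 4 \<Rightarrow> real ^ 4 \<Rightarrow> (real ^ 4) set" where
  "unit_circle p q = {w \<in> span {p, q}. norm w = 1}"

definition uniformly_converges_to :: "(real \<Rightarrow> real ^ 4) \<Rightarrow> (real \<Rightarrow> real ^ 4) \<Rightarrow> bool" where
  "uniformly_converges_to M N \<longleftrightarrow> (\<forall>\<epsilon>>0. \<exists>U. \<forall>u>U. norm (M u - N u) < \<epsilon>)"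

text \<open>
  At \<open>y = 0\<close> the derivative equation gives no information on \<open>v\<close>; continuity fixes \<open>v 0\<close>.
\<close>

definition unit_velocity_y :: "(real \<Rightarrow> real ^ 4) \<Rightarrow> (real \<Rightarrow> real ^ 4) \<Rightarrow> bool" where
  "unit_velocity_y u v \<longleftrightarrow>
     continuous_on UNIV v \<and>
     (\<forall>y. norm (v y) = 1 \<and> (u has_vector_derivative (y\<^sup>2 / (1 + y\<^sup>2)) *\<^sub>R v y) (at y))"

text \<open>Only the values of \<open>w\<close> and \<open>v\<close> on the positive reals matter here.\<close>

definition unit_velocity_x ::
    "(real \<Rightarrow> real ^ 4) \<Rightarrow> (real \<Rightarrow> real) \<Rightarrow> (real \<Rightarrow> real ^ 4) \<Rightarrow> bool" where
  "unit_velocity_x w T v \<longleftrightarrow>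
     (\<forall>s. T s > 0 \<and> norm (v (exp (- s))) = 1 \<and>
          ((\<lambda>s. w (exp (- s))) has_vector_derivative - (T s *\<^sub>R v (exp (- s)))) (at s))"

end

theory Submission
  imports Defs
begin

text \<open>
  Put \<open>P = X\<^sub>0' / x\<close>. The recurrence makes \<open>P (2 X\<^sub>0 - x\<^sup>2 P + sqrt 5) - P\<^sup>2 - B\<^sub>2\<^sup>2 - C\<^sub>2\<^sup>2\<close> a first
  integral, which vanishes at the origin. Hence \<open>P > 0\<close> and \<open>h > 0\<close>, and the same identity shows
  that \<open>u\<close> moves with speed exactly \<open>y\<^sup>2 / (1 + y\<^sup>2)\<close>. Since \<open>u(y)\<close> lies in the span of \<open>X\<^sub>\<beta>, \<phi>\<close>
  and \<open>ut(x)\<close> in that of \<open>X\<^sub>\<alpha>, \<xi>\<close> at the same point \<open>(x, y)\<close>, every \<open>u(y)\<close> is orthogonal to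
  every \<open>ut(x)\<close>. Each of the two curves has a nonzero velocity somewhere, so both are confined to
  two fixed complementary planes. A unit curve in a plane is determined by its angle, an
  antiderivative of its speed: \<open>y - arctan y + const\<close> for \<open>u\<close>, and for \<open>ut(exp (-s))\<close> an
  antiderivative of \<open>-T(exp (-s))\<close>, where \<open>T\<close> is differentiable at \<open>0\<close> with \<open>T(0) = sqrt 5 / 2\<close>.
\<close>

subsection \<open>The power series \<open>X\<^sub>0\<close> and its first integral\<close>

text \<open>These are \<open>X\<^sub>0' / x\<close> and its derivative, given by series so as to be smooth at \<open>x = 0\<close>.\<close>

definition slope :: "real \<Rightarrow> real" where
  "slope x = 2 * (\<Sum>k. diffs X0_coeff k * (x\<^sup>2) ^ k)"

definition slope' :: "real \<Rightarrow> real" where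
  "slope' x = 4 * x * (\<Sum>k. diffs (diffs X0_coeff) k * (x\<^sup>2) ^ k)"

text \<open>\<open>diffs\<close> shifts the index of the series, whereas the Euler operator
  \<open>z d/dz\<close> in the third part keeps it. A recurrence with coefficients polynomial in
  \<open>k\<close> thereby turns into a differential equation.\<close>

lemma entire_power_series:
  fixes c :: "nat \<Rightarrow> real"
  assumes c: "\<And>z. summable (\<lambda>k. c k * z ^ k)"
  shows "summable (\<lambda>k. diffs c k * z ^ k)"
    and "((\<lambda>z. \<Sum>k. c k * z ^ k) has_real_derivative (\<Sum>k. diffs c k * z ^ k)) (at z)"
    and "(\<lambda>k. (real k * c k) * z ^ k) sums (z * (\<Sum>k. diffs c k * z ^ k))"
proof -
  show s: "summable (\<lambda>k. diffs c k * z ^ k)"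
    using termdiff_converges_all[OF c] .
  show "((\<lambda>z. \<Sum>k. c k * z ^ k) has_real_derivative (\<Sum>k. diffs c k * z ^ k)) (at z)"
    by (rule termdiffs_strong_converges_everywhere[OF c])
  have "(\<lambda>k. z * (diffs c k * z ^ k)) sums (z * (\<Sum>k. diffs c k * z ^ k))"
    using s by (intro sums_mult summable_sums)
  then have "(\<lambda>k. (real (Suc k) * c (Suc k)) * z ^ Suc k) sums (z * (\<Sum>k. diffs c k * z ^ k))"
    by (simp add: diffs_def mult_ac)
  then show "(\<lambda>k. (real k * c k) * z ^ k) sums (z * (\<Sum>k. diffs c k * z ^ k))"
    by (subst (asm) sums_Suc_iff) simp
qed

text \<open>The case \<open>k = 0\<close> is covered too: the constant term \<open>5/2\<close> is
  exactly what \<open>a_1 = 1\<close> forces. Hence the resulting differential equation is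
  homogeneous.\<close>

lemma X0_coeff_rec:
  "2 * (real k + 1) * (4 * (real k)\<^sup>2 + 5 / 4) * X0_coeff (Suc k) + (2 * real k - 1) * X0_coeff k = 0"
proof (cases k)
  case (Suc n)
  define p where "p = 2 * (real (Suc n) + 1) * (4 * (real (Suc n))\<^sup>2 + 5 / 4)"
  have "4 * (real (Suc n))\<^sup>2 + 5 / 4 > 0"
    by (rule add_nonneg_pos) auto
  then have "p > 0"
    unfolding p_def by (intro mult_pos_pos) auto
  then show ?thesis
    unfolding Suc X0_coeff.simps p_def[symmetric] by simp
qed simp

text \<open>The crude estimate \<open>|2t - 1| \<le> 2(4t^2 + 5/4)\<close> cancels everything in the
  recurrence except the factor \<open>k + 1\<close>. The coefficients therefore decay like
  \<open>1 / k!\<close>, and the exponential series is a majorant.\<close>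

lemma X0_coeff_bound: "\<bar>X0_coeff (Suc k)\<bar> \<le> \<bar>X0_coeff k\<bar> / (real k + 1)"
proof -
  have p: "4 * (real k)\<^sup>2 + 5 / 4 > 0"
    by (rule add_nonneg_pos) auto
  have b: "\<bar>2 * t - 1\<bar> \<le> 2 * (4 * t\<^sup>2 + 5 / 4)" for t :: real
  proof -
    have "2 * t \<le> t * t + 1" "- (2 * t) \<le> t * t + 1" "0 \<le> t * t"
      using zero_le_power2[of "t - 1"] zero_le_power2[of "t + 1"]
      by (auto simp: power2_eq_square algebra_simps)
    then have "\<bar>2 * t - 1\<bar> \<le> t * t + 2"
      by (intro abs_leI) simp_all
    also have "\<dots> \<le> 2 * (4 * (t * t) + 5 / 4)"
      by (simp add: add_increasing)
    finally show ?thesis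
      unfolding power2_eq_square .
  qed
  have "2 * (real k + 1) * (4 * (real k)\<^sup>2 + 5 / 4) * \<bar>X0_coeff (Suc k)\<bar>
      = \<bar>2 * (real k + 1) * (4 * (real k)\<^sup>2 + 5 / 4) * X0_coeff (Suc k)\<bar>"
    using p by (simp add: abs_mult)
  also have "\<dots> = \<bar>2 * real k - 1\<bar> * \<bar>X0_coeff k\<bar>"
    using X0_coeff_rec[of k] by (simp add: abs_mult[symmetric])
  also have "\<dots> \<le> 2 * (4 * (real k)\<^sup>2 + 5 / 4) * \<bar>X0_coeff k\<bar>"
    using b by (intro mult_right_mono) auto
  finally have "(2 * (4 * (real k)\<^sup>2 + 5 / 4)) * ((real k + 1) * \<bar>X0_coeff (Suc k)\<bar>)
      \<le> (2 * (4 * (real k)\<^sup>2 + 5 / 4)) * \<bar>X0_coeff k\<bar>"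
    by (simp only: mult_ac)
  then have "(real k + 1) * \<bar>X0_coeff (Suc k)\<bar> \<le> \<bar>X0_coeff k\<bar>"
    using p by (subst (asm) mult_le_cancel_left_pos) auto
  then show ?thesis
    by (simp add: field_simps)
qed

lemma summable_X0_coeff: "summable (\<lambda>k. X0_coeff k * z ^ k)"
proof (rule summable_comparison_test)
  have "\<bar>X0_coeff k\<bar> \<le> 5 / 2 / fact k" for k
  proof (induction k)
    case (Suc k)
    have "\<bar>X0_coeff (Suc k)\<bar> \<le> \<bar>X0_coeff k\<bar> / (real k + 1)"
      by (rule X0_coeff_bound)
    also have "\<dots> \<le> 5 / 2 / fact k / (real k + 1)"
      using Suc by (intro divide_right_mono) auto
    finally show ?case
      by (simp add: field_simps)
  qed simp
  then have "norm (X0_coeff k * z ^ k) \<le> 5 / 2 * (inverse (fact k) * \<bar>z\<bar> ^ k)" for k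
    using mult_right_mono[of "\<bar>X0_coeff k\<bar>" "5 / 2 / fact k" "\<bar>z\<bar> ^ k"]
    by (simp add: abs_mult power_abs field_simps)
  then show "\<exists>N. \<forall>k\<ge>N. norm (X0_coeff k * z ^ k) \<le> 5 / 2 * (inverse (fact k) * \<bar>z\<bar> ^ k)"
    by blast
  show "summable (\<lambda>k. 5 / 2 * (inverse (fact k) * \<bar>z\<bar> ^ k))"
    by (intro summable_mult summable_exp)
qed

section \<open>Derivatives and the differential equation\<close>

lemma X0_has_derivative: "(X0 has_real_derivative x * slope x) (at x)"
proof -
  have "((\<lambda>x. \<Sum>k. X0_coeff k * (x\<^sup>2) ^ k) has_real_derivative
        (\<Sum>k. diffs X0_coeff k * (x\<^sup>2) ^ k) * (2 * x)) (at x)"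
    by (rule DERIV_chain2[OF entire_power_series(2)[OF summable_X0_coeff]])
      (auto intro!: derivative_eq_intros)
  moreover have "X0 = (\<lambda>x. \<Sum>k. X0_coeff k * (x\<^sup>2) ^ k)"
    by (simp add: X0_def fun_eq_iff power_mult)
  ultimately show ?thesis
    by (simp add: slope_def mult_ac)
qed

lemma slope_has_derivative: "(slope has_real_derivative slope' x) (at x)"
proof -
  have "((\<lambda>x. \<Sum>k. diffs X0_coeff k * (x\<^sup>2) ^ k) has_real_derivative
        (\<Sum>k. diffs (diffs X0_coeff) k * (x\<^sup>2) ^ k) * (2 * x)) (at x)"
    by (rule DERIV_chain2[OF entire_power_series(2)[OF entire_power_series(1)[OF summable_X0_coeff]]])
      (auto intro!: derivative_eq_intros)
  from DERIV_cmult[OF this, of 2] show ?thesis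
    by (simp add: slope_def[abs_def] slope'_def mult_ac)
qed

text \<open>Summing the recurrence against \<open>z^k\<close> at \<open>z = x^2\<close> gives this
  second-order equation for \<open>slope\<close>. It is stated for \<open>x * d\<close>, so that it
  holds at \<open>x = 0\<close> without division.\<close>

lemma euler_slope_derivative:
  obtains d where "((\<lambda>x. x * slope' x) has_real_derivative d) (at x)"
    "x * d = X0 x - 5 / 4 * slope x - x\<^sup>2 * slope x"
proof -
  define c where "c k = real k * diffs X0_coeff k" for k
  note s1 = entire_power_series(1)[OF summable_X0_coeff]
  have e: "(\<lambda>k. c k * z ^ k) sums (z * (\<Sum>k. diffs (diffs X0_coeff) k * z ^ k))" for z
    unfolding c_def by (rule entire_power_series(3)[OF s1])
  then have sc: "summable (\<lambda>k. c k * z ^ k)" for z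
    using sums_summable by blast
  have eq: "x * slope' x = 4 * (\<Sum>k. c k * (x\<^sup>2) ^ k)" for x
    using sums_unique[OF e[of "x\<^sup>2"]] by (simp add: slope'_def power2_eq_square)
  define d where "d = 8 * x * (\<Sum>k. diffs c k * (x\<^sup>2) ^ k)"
  have "((\<lambda>x. \<Sum>k. c k * (x\<^sup>2) ^ k) has_real_derivative
        (\<Sum>k. diffs c k * (x\<^sup>2) ^ k) * (2 * x)) (at x)"
    by (rule DERIV_chain2[OF entire_power_series(2)[OF sc]]) (auto intro!: derivative_eq_intros)
  from DERIV_cmult[OF this, of 4] have "((\<lambda>x. x * slope' x) has_real_derivative d) (at x)"
    by (simp add: eq d_def mult_ac)
  note d = this
  define z where "z = x\<^sup>2"
  \<comment> \<open>The four summands are the pieces \<open>8k^2(k+1) a_(k+1)\<close>,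
    \<open>5/2 (k+1) a_(k+1)\<close>, \<open>2k a_k\<close> and \<open>- a_k\<close> of the expanded
    recurrence.\<close>
  have "(\<lambda>k. 8 * ((real k * c k) * z ^ k) + (5 / 2 * (diffs X0_coeff k * z ^ k)
        + (2 * ((real k * X0_coeff k) * z ^ k) - X0_coeff k * z ^ k)))
    sums (8 * (z * (\<Sum>k. diffs c k * z ^ k)) + (5 / 2 * (\<Sum>k. diffs X0_coeff k * z ^ k)
        + (2 * (z * (\<Sum>k. diffs X0_coeff k * z ^ k)) - (\<Sum>k. X0_coeff k * z ^ k))))"
    by (intro sums_add sums_diff sums_mult entire_power_series(3) sc summable_sums s1 summable_X0_coeff)
  moreover have "8 * ((real k * c k) * z ^ k) + (5 / 2 * (diffs X0_coeff k * z ^ k)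
        + (2 * ((real k * X0_coeff k) * z ^ k) - X0_coeff k * z ^ k))
      = (2 * (real k + 1) * (4 * (real k)\<^sup>2 + 5 / 4) * X0_coeff (Suc k) + (2 * real k - 1) * X0_coeff k)
        * z ^ k" for k
    by (simp add: c_def diffs_def algebra_simps power2_eq_square)
  ultimately have "(\<lambda>k. 0) sums (8 * (z * (\<Sum>k. diffs c k * z ^ k)) + (5 / 2 * (\<Sum>k. diffs X0_coeff k * z ^ k)
        + (2 * (z * (\<Sum>k. diffs X0_coeff k * z ^ k)) - (\<Sum>k. X0_coeff k * z ^ k))))"
    by (simp only: X0_coeff_rec mult_zero_left)
  then have "8 * (z * (\<Sum>k. diffs c k * z ^ k)) + (5 / 2 * (\<Sum>k. diffs X0_coeff k * z ^ k)
        + (2 * (z * (\<Sum>k. diffs X0_coeff k * z ^ k)) - (\<Sum>k. X0_coeff k * z ^ k))) = 0"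
    using sums_unique2 sums_zero by blast
  then have "x * d = X0 x - 5 / 4 * slope x - x\<^sup>2 * slope x"
    by (simp add: d_def slope_def X0_def z_def power_mult) (simp add: power2_eq_square algebra_simps)
  with d show thesis
    by (rule that)
qed

lemma X0_slope_at_zero: "X0 0 = 5 / 2" "slope 0 = 2"
proof -
  have "(\<Sum>k. c k * 0 ^ k) = c 0" for c :: "nat \<Rightarrow> real"
    using suminf_finite[of "{0}" "\<lambda>k. c k * 0 ^ k"] by simp
  then show "X0 0 = 5 / 2" "slope 0 = 2"
    by (auto simp: X0_def slope_def power_mult diffs_def)
qed

text \<open>The difference \<open>E\<close> of the two sides has derivative zero by the differential
  equation, and \<open>E 0 = 2(5 + sqrt 5) - 4 - (1 + sqrt 5)^2 = 0\<close>.\<close>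

lemma first_integral:
  "slope x * (2 * X0 x - x\<^sup>2 * slope x + sqrt 5)
    = (slope x)\<^sup>2 + (slope x / 2 + sqrt 5)\<^sup>2 + (x * slope' x)\<^sup>2"
proof -
  define E where "E x = slope x * (2 * X0 x - x\<^sup>2 * slope x + sqrt 5)
    - ((slope x)\<^sup>2 + (slope x / 2 + sqrt 5)\<^sup>2 + (x * slope' x)\<^sup>2)" for x
  have "(E has_real_derivative 0) (at x)" for x
  proof -
    obtain d where d: "((\<lambda>x. x * slope' x) has_real_derivative d) (at x)"
      "x * d = X0 x - 5 / 4 * slope x - x\<^sup>2 * slope x"
      by (rule euler_slope_derivative)
    define R where "R = (\<lambda>x. x * slope' x)"
    have E: "E = (\<lambda>x. slope x * (2 * X0 x - x\<^sup>2 * slope x + sqrt 5)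
        - ((slope x)\<^sup>2 + (slope x / 2 + sqrt 5)\<^sup>2 + (R x)\<^sup>2))"
      by (simp add: E_def R_def fun_eq_iff)
    have "(E has_real_derivative
        slope x * (2 * (x * slope x) - (2 * x * slope x + x\<^sup>2 * slope' x))
        + slope' x * (2 * X0 x - x\<^sup>2 * slope x + sqrt 5)
        - (2 * slope x * slope' x + (slope x / 2 + sqrt 5) * slope' x + 2 * R x * d)) (at x)"
      unfolding E
      by (auto intro!: derivative_eq_intros X0_has_derivative slope_has_derivative d(1)[folded R_def])
    \<comment> \<open>The factor \<open>x\<close> inside \<open>R x\<close> supplies the
      \<open>x * d\<close> that the differential equation determines.\<close>
    moreover have "R x * d = slope' x * (X0 x - 5 / 4 * slope x - x\<^sup>2 * slope x)"
      using d(2) by (simp add: R_def)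
    then have "slope x * (2 * (x * slope x) - (2 * x * slope x + x\<^sup>2 * slope' x))
        + slope' x * (2 * X0 x - x\<^sup>2 * slope x + sqrt 5)
        - (2 * slope x * slope' x + (slope x / 2 + sqrt 5) * slope' x + 2 * R x * d) = 0"
      by (simp only: mult.assoc) (simp add: algebra_simps)
    ultimately show ?thesis
      by simp
  qed
  then have "E x = E 0"
    by (rule DERIV_isconst_all[rule_format])
  moreover have "E 0 = 0"
    by (simp add: E_def X0_slope_at_zero power2_eq_square algebra_simps)
  ultimately show ?thesis
    by (simp add: E_def)
qed

text \<open>At a zero of \<open>slope\<close> the first integral would read \<open>0 = 5 +\<close> a
  square. So \<open>slope\<close> never vanishes and keeps the sign of
  \<open>slope 0 = 2\<close>.\<close>

lemma slope_pos: "slope x > 0"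
proof (rule ccontr)
  assume "\<not> slope x > 0"
  moreover have "continuous_on UNIV slope"
    using slope_has_derivative DERIV_isCont continuous_at_imp_continuous_on by blast
  then have "connected (range slope)"
    using connected_continuous_image connected_UNIV by blast
  ultimately have "0 \<in> range slope"
    using connectedD_interval[of "range slope" "slope x" "slope 0" 0] X0_slope_at_zero by auto
  then obtain z where "slope z = 0" by auto
  with first_integral[of z] have "0 = 5 + (z * slope' z)\<^sup>2"
    by simp
  then show False
    by (smt (verit) zero_le_power2)
qed

text \<open>The derivative \<open>t * slope t\<close> has the sign of \<open>t\<close>, so by the
  mean value theorem \<open>X0\<close> is smallest at the origin. The bound gives the sign of
  \<open>transverse_rate\<close>.\<close>

lemma X0_ge: "X0 x \<ge> 5 / 2"
proof (cases "x = 0")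
  case False
  have "\<exists>t. 0 \<le> t * x \<and> X0 x - X0 0 = x * (t * slope t)"
  proof (cases "x > 0")
    case True
    then obtain t where "0 < t" "X0 x - X0 0 = (x - 0) * (t * slope t)"
      using MVT2[of 0 x X0 "\<lambda>t. t * slope t"] X0_has_derivative by auto
    with True show ?thesis
      by (intro exI[of _ t]) auto
  next
    case False
    with \<open>x \<noteq> 0\<close> obtain t where "x < t" "t < 0" "X0 0 - X0 x = (0 - x) * (t * slope t)"
      using MVT2[of x 0 X0 "\<lambda>t. t * slope t"] X0_has_derivative by auto
    then show ?thesis
      by (intro exI[of _ t]) (auto simp: mult_nonpos_nonpos)
  qed
  then obtain t where "0 \<le> t * x" "X0 x - X0 0 = (t * x) * slope t"
    by (auto simp: mult_ac)
  then show ?thesis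
    using slope_pos[of t] X0_slope_at_zero by (smt (verit) mult_nonneg_nonneg)
qed (simp add: X0_slope_at_zero)

lemma dX0_eq: "dX0 x = x * slope x"
  unfolding dX0_def using X0_has_derivative by (rule DERIV_imp_deriv)

lemma ddX0_eq: "ddX0 x = slope x + x * slope' x"
proof -
  have "(dX0 has_real_derivative slope x + x * slope' x) (at x)"
    unfolding dX0_eq[abs_def]
    by (rule derivative_eq_intros slope_has_derivative refl)+ simp
  then show ?thesis
    unfolding ddX0_def by (rule DERIV_imp_deriv)
qed

subsection \<open>Unit curves in a plane\<close>

lemma orthonormal_frame_iff:
  "orthonormal_frame [a, b, c, d] \<longleftrightarrow>
    norm a = 1 \<and> norm b = 1 \<and> norm c = 1 \<and> norm d = 1 \<and>
    a \<bullet> b = 0 \<and> a \<bullet> c = 0 \<and> a \<bullet> d = 0 \<and> b \<bullet> c = 0 \<and> b \<bullet> d = 0 \<and> c \<bullet> d = 0"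
  by (simp add: orthonormal_frame_def All_less_Suc numeral_eq_Suc norm_eq_1 inner_commute) blast

text \<open>Four orthonormal vectors span the space by dimension. The remainder \<open>z\<close> is
  orthogonal to all of them, hence to itself.\<close>

lemma orthonormal_frame_expand:
  assumes "orthonormal_frame [a, b, c, d]" "w \<bullet> a = 0" "w \<bullet> b = 0"
  shows "w = (w \<bullet> c) *\<^sub>R c + (w \<bullet> d) *\<^sub>R d"
proof -
  let ?S = "{a, b, c, d}"
  note o = assms(1)[unfolded orthonormal_frame_iff norm_eq_1]
  have distinct: "a \<noteq> b" "a \<noteq> c" "a \<noteq> d" "b \<noteq> c" "b \<noteq> d" "c \<noteq> d"
    using o by auto
  have "pairwise orthogonal ?S" "0 \<notin> ?S"
    using o by (auto simp: pairwise_def orthogonal_def inner_commute)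
  then have "independent ?S"
    by (rule pairwise_orthogonal_independent)
  moreover have "dim (UNIV :: (real ^ 4) set) \<le> card ?S"
    using distinct by simp
  ultimately have "UNIV \<subseteq> span ?S"
    by (intro card_ge_dim_independent) auto
  moreover define z where "z = w - ((w \<bullet> c) *\<^sub>R c + (w \<bullet> d) *\<^sub>R d)"
  have "orthogonal z s" if "s \<in> ?S" for s
    using that assms(2,3) o
    by (auto simp: z_def orthogonal_def inner_diff_left inner_diff_right inner_add_left inner_add_right inner_commute)
  then have "orthogonal z s" if "s \<in> span ?S" for s
    using that by (rule orthogonal_to_span[rotated])
  ultimately have "orthogonal z z"
    by blast
  then show ?thesis
    by (simp add: z_def orthogonal_def)
qed

lemma inner_orthonormal_frame:
  assumes "orthonormal_frame [a, b, c, d]"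
  shows "(p1 *\<^sub>R a + p2 *\<^sub>R b + p3 *\<^sub>R c + p4 *\<^sub>R d) \<bullet> (q1 *\<^sub>R a + q2 *\<^sub>R b + q3 *\<^sub>R c + q4 *\<^sub>R d)
    = p1 * q1 + p2 * q2 + p3 * q3 + p4 * q4"
  using assms unfolding orthonormal_frame_iff norm_eq_1
  by (simp add: inner_add_left inner_add_right inner_commute)

lemma inner_planar:
  fixes a b :: "'a::real_inner"
  assumes "norm a = 1" "norm b = 1" "a \<bullet> b = 0"
  shows "(p1 *\<^sub>R a + p2 *\<^sub>R b) \<bullet> (q1 *\<^sub>R a + q2 *\<^sub>R b) = p1 * q1 + p2 * q2"
  using assms unfolding norm_eq_1
  by (simp add: inner_add_left inner_add_right inner_commute)

text \<open>\<open>V\<close> is \<open>W\<close> turned by a right angle in a fixed sense, so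
  \<open>V' = - g W\<close>, and turning the pair back by the angle \<open>G\<close> yields constant
  vectors. Where \<open>g\<close> vanishes, \<open>W'\<close> says nothing about \<open>V\<close>;
  continuity of \<open>V\<close> is what fixes the sense of rotation there.\<close>

lemma planar_rotation:
  fixes W V :: "real \<Rightarrow> 'a::real_inner"
  assumes W': "\<And>t. (W has_vector_derivative g t *\<^sub>R V t) (at t)"
    and G': "\<And>t. (G has_real_derivative g t) (at t)"
    and V: "continuous_on UNIV V"
    and unit: "\<And>t. norm (W t) = 1" "\<And>t. norm (V t) = 1" "\<And>t. W t \<bullet> V t = 0"
    and ab: "norm a = 1" "norm b = 1" "a \<bullet> b = 0"
    and Wab: "\<And>t. W t = (W t \<bullet> a) *\<^sub>R a + (W t \<bullet> b) *\<^sub>R b"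
    and Vab: "\<And>t. V t = (V t \<bullet> a) *\<^sub>R a + (V t \<bullet> b) *\<^sub>R b"
  obtains p q where "norm p = 1" "norm q = 1" "p \<bullet> q = 0" "p \<in> span {a, b}" "q \<in> span {a, b}"
    "\<And>t. W t = cos (G t) *\<^sub>R p + sin (G t) *\<^sub>R q"
    "\<And>t. V t = - (sin (G t) *\<^sub>R p) + cos (G t) *\<^sub>R q"
proof -
  define W1 where "W1 t = W t \<bullet> a" for t
  define W2 where "W2 t = W t \<bullet> b" for t
  define V1 where "V1 t = V t \<bullet> a" for t
  define V2 where "V2 t = V t \<bullet> b" for t
  note Weq = Wab[folded W1_def W2_def] and Veq = Vab[folded V1_def V2_def]
  have W: "continuous_on UNIV W"
    using W' has_vector_derivative_continuous continuous_at_imp_continuous_on by blast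
  have WW: "W1 t * W1 t + W2 t * W2 t = 1" and VV: "V1 t * V1 t + V2 t * V2 t = 1"
    and WV: "W1 t * V1 t + W2 t * V2 t = 0" for t
    using unit(1)[of t, unfolded norm_eq_1] unit(2)[of t, unfolded norm_eq_1] unit(3)[of t]
    unfolding Weq[of t] Veq[of t] inner_planar[OF ab] .
  \<comment> \<open>The determinant of \<open>W\<close>, \<open>V\<close> in the basis
    \<open>a\<close>, \<open>b\<close>. By Lagrange's identity its square is 1, so it is a
    continuous function with values in \<open>{1, -1}\<close> and hence constant.\<close>
  define \<sigma> where "\<sigma> t = W1 t * V2 t - W2 t * V1 t" for t
  have sq: "\<sigma> t * \<sigma> t = 1" for t
  proof -
    have "\<sigma> t * \<sigma> t + (W1 t * V1 t + W2 t * V2 t) * (W1 t * V1 t + W2 t * V2 t)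
      = (W1 t * W1 t + W2 t * W2 t) * (V1 t * V1 t + V2 t * V2 t)"
      by (simp add: \<sigma>_def algebra_simps)
    then show ?thesis
      by (simp add: WW VV WV)
  qed
  have "continuous_on UNIV \<sigma>"
    unfolding \<sigma>_def[abs_def] W1_def V2_def W2_def V1_def by (intro continuous_intros W V)
  moreover have "\<sigma> ` UNIV \<subseteq> {1, -1}"
    using sq by (auto simp: square_eq_1_iff)
  then have "finite (\<sigma> ` UNIV)"
    by (rule finite_subset) simp
  ultimately have "\<sigma> constant_on UNIV"
    by (intro continuous_finite_range_constant) auto
  then obtain s where s: "\<And>t. \<sigma> t = s"
    unfolding constant_on_def by auto
  have ss: "s * s = 1"
    using sq[of 0] s by simp
  have VJ: "V1 t = - (s * W2 t)" "V2 t = s * W1 t" for t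
  proof -
    have "\<sigma> t * W2 t = W1 t * (W1 t * V1 t + W2 t * V2 t) - V1 t * (W1 t * W1 t + W2 t * W2 t)"
      by (simp add: \<sigma>_def algebra_simps)
    then show "V1 t = - (s * W2 t)"
      by (simp add: s WW WV)
    have "\<sigma> t * W1 t = V2 t * (W1 t * W1 t + W2 t * W2 t) - W2 t * (W1 t * V1 t + W2 t * V2 t)"
      by (simp add: \<sigma>_def algebra_simps)
    then show "V2 t = s * W1 t"
      by (simp add: s WW WV)
  qed
  have W1': "(W1 has_real_derivative g t * V1 t) (at t)" and W2': "(W2 has_real_derivative g t * V2 t) (at t)" for t
    unfolding W1_def[abs_def] W2_def[abs_def] V1_def V2_def has_real_derivative_iff_has_vector_derivative
    using bounded_linear.has_vector_derivative[OF bounded_linear_inner_left W'] by simp_all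
  have V': "(V has_vector_derivative - (g t *\<^sub>R W t)) (at t)" for t
  proof -
    have "((\<lambda>t. (- (s * W2 t)) *\<^sub>R a + (s * W1 t) *\<^sub>R b) has_vector_derivative
        (- (s * (g t * V2 t))) *\<^sub>R a + (s * (g t * V1 t)) *\<^sub>R b) (at t)"
      by (auto intro!: derivative_eq_intros W1' W2'
          simp: has_real_derivative_iff_has_vector_derivative[symmetric] mult_ac)
    moreover have "V = (\<lambda>t. (- (s * W2 t)) *\<^sub>R a + (s * W1 t) *\<^sub>R b)"
      using Veq by (auto simp: VJ fun_eq_iff)
    moreover have "- (s * (g t * V2 t)) = - ((s * s) * g t * W1 t)"
      "s * (g t * V1 t) = - ((s * s) * g t * W2 t)"
      by (simp_all add: VJ)
    then have "(- (s * (g t * V2 t))) *\<^sub>R a + (s * (g t * V1 t)) *\<^sub>R b = - (g t *\<^sub>R W t)"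
      by (subst Weq) (simp add: ss scaleR_add_right)
    ultimately show ?thesis
      by simp
  qed
  \<comment> \<open>The pair \<open>W\<close>, \<open>V\<close> rotated back by \<open>G\<close>; in
    the derivatives the terms from \<open>G' = g\<close> cancel those from \<open>W' = g V\<close>
    and \<open>V' = - g W\<close>.\<close>
  define p where "p t = cos (G t) *\<^sub>R W t - sin (G t) *\<^sub>R V t" for t
  define q where "q t = sin (G t) *\<^sub>R W t + cos (G t) *\<^sub>R V t" for t
  have cG: "((\<lambda>t. cos (G t)) has_real_derivative - (sin (G t) * g t)) (at t)"
    and sG: "((\<lambda>t. sin (G t)) has_real_derivative cos (G t) * g t) (at t)" for t
    by (auto intro!: derivative_eq_intros G')
  have "(p has_vector_derivative 0) (at t within UNIV)" and "(q has_vector_derivative 0) (at t within UNIV)" for t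
    unfolding p_def[abs_def] q_def[abs_def]
    using has_vector_derivative_diff[OF has_vector_derivative_scaleR[OF cG W'] has_vector_derivative_scaleR[OF sG V']]
      has_vector_derivative_add[OF has_vector_derivative_scaleR[OF sG W'] has_vector_derivative_scaleR[OF cG V']]
    by (simp_all add: mult.commute)
  then have const: "p t = p 0" "q t = q 0" for t
    using has_vector_derivative_zero_constant[of UNIV p] has_vector_derivative_zero_constant[of UNIV q]
    by (metis UNIV_I convex_UNIV)+
  have tt: "cos x * cos x = 1 - sin x * sin x" for x :: real
    using sin_cos_squared_add[of x] by (simp add: power2_eq_square)
  have rot: "c *\<^sub>R (c *\<^sub>R w - s *\<^sub>R v) + s *\<^sub>R (s *\<^sub>R w + c *\<^sub>R v) = (c * c + s * s) *\<^sub>R w"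
    "- (s *\<^sub>R (c *\<^sub>R w - s *\<^sub>R v)) + c *\<^sub>R (s *\<^sub>R w + c *\<^sub>R v) = (c * c + s * s) *\<^sub>R v"
    for c s and w v :: 'a
    by (simp_all add: algebra_simps)
  show thesis
  proof
    have d: "W 0 \<bullet> W 0 = 1" "V 0 \<bullet> V 0 = 1" "W 0 \<bullet> V 0 = 0" "V 0 \<bullet> W 0 = 0"
      using unit[of 0] by (auto simp: norm_eq_1 inner_commute)
    show "norm (p 0) = 1" "norm (q 0) = 1" "p 0 \<bullet> q 0 = 0"
      by (simp_all add: norm_eq_1 p_def q_def inner_diff_left inner_diff_right inner_add_left inner_add_right d tt)
    have "W 0 \<in> span {a, b}" "V 0 \<in> span {a, b}"
      by (subst Wab Vab, intro span_add span_scale span_base; simp)+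
    then show "p 0 \<in> span {a, b}" "q 0 \<in> span {a, b}"
      by (auto simp: p_def q_def intro!: span_add span_diff span_scale)
    show "W t = cos (G t) *\<^sub>R p 0 + sin (G t) *\<^sub>R q 0" for t
      using rot(1)[of "cos (G t)" "W t" "sin (G t)" "V t", folded p_def q_def]
      by (simp add: const[of t])
    show "V t = - (sin (G t) *\<^sub>R p 0) + cos (G t) *\<^sub>R q 0" for t
      using rot(2)[of "sin (G t)" "cos (G t)" "W t" "V t", folded p_def q_def]
      by (simp add: const[of t])
  qed
qed

lemma uniformly_converges_to_iff:
  "uniformly_converges_to M N \<longleftrightarrow> ((\<lambda>t. M t - N t) \<longlongrightarrow> 0) at_top"
  by (simp add: uniformly_converges_to_def tendsto_iff eventually_at_top_dense)

text \<open>By the sum-to-product formulas \<open>cos\<close> and \<open>sin\<close> are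
  1-Lipschitz, so it suffices that the difference of the angles tends to zero.\<close>

lemma uniformly_converges_to_circle:
  fixes p q :: "real ^ 4"
  assumes "((\<lambda>t. G t - L t) \<longlongrightarrow> 0) at_top"
  shows "uniformly_converges_to (\<lambda>t. cos (G t) *\<^sub>R p + sin (G t) *\<^sub>R q) (\<lambda>t. cos (L t) *\<^sub>R p + sin (L t) *\<^sub>R q)"
proof -
  have b: "\<bar>2 * x * sin (z / 2)\<bar> \<le> \<bar>z\<bar>" if "\<bar>x\<bar> \<le> 1" for x z :: real
    using mult_mono[OF that abs_sin_x_le_abs_x[of "z / 2"]] by (simp add: abs_mult)
  have "\<bar>cos a - cos b\<bar> \<le> \<bar>a - b\<bar>" "\<bar>sin a - sin b\<bar> \<le> \<bar>a - b\<bar>" for a b :: real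
    using b[of "sin ((a + b) / 2)" "b - a"] b[of "cos ((a + b) / 2)" "a - b"]
    by (simp_all add: cos_diff_cos sin_diff_sin mult_ac)
  then have "((\<lambda>t. cos (G t) - cos (L t)) \<longlongrightarrow> 0) at_top" "((\<lambda>t. sin (G t) - sin (L t)) \<longlongrightarrow> 0) at_top"
    by (auto intro!: Lim_null_comparison[OF _ tendsto_rabs_zero[OF assms]] always_eventually)
  from tendsto_add[OF tendsto_scaleR[OF this(1) tendsto_const[of p]] tendsto_scaleR[OF this(2) tendsto_const[of q]]]
  show ?thesis
    by (simp add: uniformly_converges_to_iff algebra_simps)
qed

text \<open>Serves at \<open>y = 0\<close>, where the speed \<open>y^2 / (1 + y^2)\<close> vanishes
  and the velocity equation leaves the unit direction open.\<close>

lemma eq_if_eq_off_zero: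
  fixes f g :: "real \<Rightarrow> 'a::real_normed_vector"
  assumes "continuous_on UNIV f" "continuous_on UNIV g" "\<And>y. y \<noteq> 0 \<Longrightarrow> f y = g y"
  shows "f = g"
proof -
  have "(f \<longlongrightarrow> f 0) (at 0)" "(g \<longlongrightarrow> g 0) (at 0)"
    using assms(1,2) by (auto simp: continuous_on_def)
  moreover have "(f \<longlongrightarrow> l) (at 0) \<longleftrightarrow> (g \<longlongrightarrow> l) (at 0)" for l
    by (intro tendsto_cong) (auto simp: eventually_at_filter assms(3))
  ultimately have "f 0 = g 0"
    using tendsto_unique[OF trivial_limit_at] by blast
  with assms(3) show ?thesis
    by (intro ext) metis
qed

subsection \<open>The curve \<open>u\<close>\<close>

lemma h_fun_eq: "x > 0 \<Longrightarrow> h_fun x y = 2 * X0 x - x\<^sup>2 * slope x + y\<^sup>2 * slope x + sqrt 5"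
  by (simp add: h_fun_def dX0_eq power2_eq_square)

lemma B2_eq: "x > 0 \<Longrightarrow> B2 x = - (slope x / 2) - sqrt 5"
  by (simp add: B2_def dX0_eq)

lemma C2_eq: "x > 0 \<Longrightarrow> C2 x = x * slope' x"
  by (simp add: C2_def dX0_eq ddX0_eq)

text \<open>The first integral, with \<open>y^2 * (slope x)^2\<close> added to both sides. It yields
  both the positivity of \<open>h_fun\<close> and the exact speed of \<open>u\<close>.\<close>

lemma h_fun_mult_slope:
  assumes "x > 0"
  shows "h_fun x y * slope x = (1 + y\<^sup>2) * (slope x)\<^sup>2 + ((B2 x)\<^sup>2 + (C2 x)\<^sup>2)"
  using first_integral[of x] assms
  by (simp add: h_fun_eq B2_eq C2_eq power2_eq_square algebra_simps)

lemma h_fun_pos: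
  assumes "x > 0"
  shows "h_fun x y > 0"
proof -
  have "0 < (1 + y\<^sup>2) * (slope x)\<^sup>2 + ((B2 x)\<^sup>2 + (C2 x)\<^sup>2)"
    using slope_pos[of x] by (intro add_pos_nonneg mult_pos_pos add_nonneg_nonneg) auto
  then have "0 < h_fun x y * slope x"
    by (simp add: h_fun_mult_slope[OF assms])
  then show ?thesis
    using slope_pos[of x] by (simp add: zero_less_mult_iff)
qed

text \<open>These proportionalities are why \<open>u\<close> does not depend on \<open>x\<close> and
  \<open>ut\<close> not on \<open>y\<close>. For \<open>coef_a2\<close>, the numerator is
  \<open>h_fun x y - 2 * y^2 * slope x\<close>.\<close>

lemma coef_relations:
  assumes "x > 0"
  shows "coef_a1 x y = - y * coef_c1 x y"
    and "coef_a2 x y = y\<^sup>2 * (2 / h_fun x y) * slope x - 1"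
    and "coef_b2 x y = y * (2 / h_fun x y) * B2 x"
    and "coef_c2 x y = y * (2 / h_fun x y) * C2 x"
proof -
  have h: "h_fun x y \<noteq> 0"
    using h_fun_pos[OF assms] by (simp add: less_imp_neq[symmetric])
  show "coef_a1 x y = - y * coef_c1 x y"
    by (simp add: coef_a1_def coef_c1_def)
  have "2 * X0 x + sqrt 5 - (x\<^sup>2 + y\<^sup>2) * slope x = h_fun x y - 2 * y\<^sup>2 * slope x"
    by (simp add: h_fun_eq[OF assms] algebra_simps)
  then show "coef_a2 x y = y\<^sup>2 * (2 / h_fun x y) * slope x - 1"
    using h assms by (simp add: coef_a2_def dX0_eq diff_divide_distrib)
  show "coef_b2 x y = y * (2 / h_fun x y) * B2 x"
    using assms by (simp add: coef_b2_def B2_eq dX0_eq algebra_simps)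
  show "coef_c2 x y = y * (2 / h_fun x y) * C2 x"
    by (simp add: coef_c2_def C2_def)
qed

lemma frame_fieldD:
  assumes "frame_field \<phi> X\<alpha> X\<beta> \<xi>" "x > 0"
  shows "orthonormal_frame [\<phi> x y, X\<alpha> x y, X\<beta> x y, \<xi> x y]"
    and "((\<lambda>s. \<phi> s y) has_vector_derivative - (coef_a1 x y *\<^sub>R X\<alpha> x y)) (at x)"
    and "((\<lambda>s. \<xi> s y) has_vector_derivative coef_b1 x y *\<^sub>R X\<alpha> x y) (at x)"
    and "((\<lambda>s. X\<beta> s y) has_vector_derivative coef_c1 x y *\<^sub>R X\<alpha> x y) (at x)"
    and "((\<lambda>s. X\<alpha> s y) has_vector_derivative
           coef_a1 x y *\<^sub>R \<phi> x y - coef_b1 x y *\<^sub>R \<xi> x y - coef_c1 x y *\<^sub>R X\<beta> x y) (at x)"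
    and "((\<lambda>t. \<phi> x t) has_vector_derivative - (coef_a2 x y *\<^sub>R X\<beta> x y)) (at y)"
    and "((\<lambda>t. \<xi> x t) has_vector_derivative coef_b2 x y *\<^sub>R X\<beta> x y) (at y)"
    and "((\<lambda>t. X\<alpha> x t) has_vector_derivative coef_c2 x y *\<^sub>R X\<beta> x y) (at y)"
    and "((\<lambda>t. X\<beta> x t) has_vector_derivative
           coef_a2 x y *\<^sub>R \<phi> x y - coef_b2 x y *\<^sub>R \<xi> x y - coef_c2 x y *\<^sub>R X\<alpha> x y) (at y)"
  using assms unfolding frame_field_def half_plane_def by auto

text \<open>Both terms of the \<open>x\<close>-derivative point along \<open>X\<alpha>\<close>, with
  total coefficient \<open>y * coef_c1 + coef_a1 = 0\<close>.\<close>

lemma u_independent_of_x: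
  assumes F: "frame_field \<phi> X\<alpha> X\<beta> \<xi>" and "x > 0" "x' > 0"
  shows "y *\<^sub>R X\<beta> x y - \<phi> x y = y *\<^sub>R X\<beta> x' y - \<phi> x' y"
proof -
  define w where "w s = y *\<^sub>R X\<beta> s y - \<phi> s y" for s
  have "(w has_vector_derivative 0) (at s within {0<..})" if "s \<in> {0<..}" for s
  proof -
    have "(w has_vector_derivative
        y *\<^sub>R (coef_c1 s y *\<^sub>R X\<alpha> s y) - - (coef_a1 s y *\<^sub>R X\<alpha> s y)) (at s)"
      unfolding w_def using that by (intro has_vector_derivative_diff frame_fieldD[OF F]
          bounded_linear.has_vector_derivative[OF bounded_linear_scaleR_right]) auto
    then show ?thesis
      using that by (simp add: coef_relations has_vector_derivative_at_within)
  qed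
  then obtain c where "\<And>s. s \<in> {0<..} \<Longrightarrow> w s = c"
    using has_vector_derivative_zero_constant[of "{0<..}" w] convex_real_interval(3)[of 0] by blast
  with assms show ?thesis
    by (simp add: w_def)
qed

text \<open>The \<open>y\<close>-derivative is \<open>C2 * coef_b2 - B2 * coef_c2\<close> times
  \<open>X\<beta>\<close>, and \<open>coef_b2\<close>, \<open>coef_c2\<close> are the same multiple
  of \<open>B2\<close>, \<open>C2\<close>.\<close>

lemma ut_independent_of_y:
  assumes F: "frame_field \<phi> X\<alpha> X\<beta> \<xi>" and "x > 0"
  shows "C2 x *\<^sub>R \<xi> x y - B2 x *\<^sub>R X\<alpha> x y = C2 x *\<^sub>R \<xi> x y' - B2 x *\<^sub>R X\<alpha> x y'"
proof -
  have "((\<lambda>t. C2 x *\<^sub>R \<xi> x t - B2 x *\<^sub>R X\<alpha> x t) has_vector_derivative 0) (at t within UNIV)" for t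
  proof -
    have "((\<lambda>t. C2 x *\<^sub>R \<xi> x t - B2 x *\<^sub>R X\<alpha> x t) has_vector_derivative
        C2 x *\<^sub>R (coef_b2 x t *\<^sub>R X\<beta> x t) - B2 x *\<^sub>R (coef_c2 x t *\<^sub>R X\<beta> x t)) (at t)"
      by (intro has_vector_derivative_diff frame_fieldD[OF assms]
          bounded_linear.has_vector_derivative[OF bounded_linear_scaleR_right])
    then show ?thesis
      using assms(2) by (simp add: coef_relations mult_ac)
  qed
  then show ?thesis
    using has_vector_derivative_zero_constant[of UNIV "\<lambda>t. C2 x *\<^sub>R \<xi> x t - B2 x *\<^sub>R X\<alpha> x t"]
    by (metis UNIV_I convex_UNIV)
qed

text \<open>Since \<open>1 + coef_a2\<close> carries a factor \<open>y^2\<close>, and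
  \<open>coef_b2\<close>, \<open>coef_c2\<close> carry a factor \<open>y\<close>, the speed
  \<open>y^2 / (1 + y^2)\<close> can be split off. What remains is an explicit \<open>v\<close>,
  continuous also at \<open>y = 0\<close>.\<close>

lemma u_derivative:
  assumes F: "frame_field \<phi> X\<alpha> X\<beta> \<xi>" and x: "x > 0"
  defines "u \<equiv> \<lambda>y. (1 / sqrt (1 + y\<^sup>2)) *\<^sub>R (y *\<^sub>R X\<beta> x y - \<phi> x y)"
  obtains v where "\<And>y. (u has_vector_derivative (y\<^sup>2 / (1 + y\<^sup>2)) *\<^sub>R v y) (at y)"
    "\<And>y. norm (u y) = 1" "\<And>y. norm (v y) = 1" "\<And>y. u y \<bullet> v y = 0" "continuous_on UNIV v"
proof -
  define s where "s y = sqrt (1 + y\<^sup>2)" for y :: real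
  define r where "r y = 2 / h_fun x y" for y
  define A where "A y = r y * slope x - 1 / (1 + y\<^sup>2)" for y
  define v where "v y = s y *\<^sub>R (A y *\<^sub>R (X\<beta> x y + y *\<^sub>R \<phi> x y) - r y *\<^sub>R (B2 x *\<^sub>R \<xi> x y + C2 x *\<^sub>R X\<alpha> x y))" for y
  have q: "1 + y\<^sup>2 > 0" for y :: real
    by (simp add: add_pos_nonneg)
  have ss: "s y * s y = 1 + y\<^sup>2" "s y > 0" for y
    using q[of y] by (auto simp: s_def)
  have k: "1 / s y = s y / (1 + y\<^sup>2)" for y
    using ss[of y] q[of y] by (simp add: field_simps)
  note coef = coef_relations(2-4)[OF x, folded r_def]
  show thesis
  proof
    show "(u has_vector_derivative (y\<^sup>2 / (1 + y\<^sup>2)) *\<^sub>R v y) (at y)" for y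
    proof -
      define k where "k = s y / (1 + y\<^sup>2)"
      define i where "i = 1 / (1 + y\<^sup>2)"
      have ds: "((\<lambda>y. 1 / s y) has_real_derivative - (k * (y * i))) (at y)"
      proof -
        have "((\<lambda>y. 1 / s y) has_real_derivative - (y / s y) / (s y * s y)) (at y)"
          unfolding s_def using q[of y]
          by (auto intro!: derivative_eq_intros simp: field_simps)
        moreover have "- (y / s y) / (s y * s y) = - ((1 / s y) * (y / (s y * s y)))"
          by simp
        ultimately show ?thesis
          by (simp only: k ss(1)) (simp add: k_def i_def)
      qed
      have "(u has_vector_derivative
         (1 / s y) *\<^sub>R ((y *\<^sub>R (coef_a2 x y *\<^sub>R \<phi> x y - coef_b2 x y *\<^sub>R \<xi> x y - coef_c2 x y *\<^sub>R X\<alpha> x y) + 1 *\<^sub>R X\<beta> x y)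
           - - (coef_a2 x y *\<^sub>R X\<beta> x y)) + (- (k * (y * i))) *\<^sub>R (y *\<^sub>R X\<beta> x y - \<phi> x y)) (at y)"
        unfolding u_def s_def[symmetric]
        by (intro has_vector_derivative_scaleR has_vector_derivative_diff ds DERIV_ident frame_fieldD[OF F x])
      moreover have "1 / s y = k"
        by (simp add: k k_def)
      moreover have "(y\<^sup>2 / (1 + y\<^sup>2)) *\<^sub>R v y = (y * y * k) *\<^sub>R (A y *\<^sub>R (X\<beta> x y + y *\<^sub>R \<phi> x y) - r y *\<^sub>R (B2 x *\<^sub>R \<xi> x y + C2 x *\<^sub>R X\<alpha> x y))"
        by (simp add: v_def k_def power2_eq_square)
      moreover have "A y = r y * slope x - i"
        by (simp add: A_def i_def)
      \<comment> \<open>With \<open>i\<close> kept as a symbol this is a polynomial identity: the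
        computed and the claimed derivative differ only along \<open>\<phi>\<close>, by a multiple
        of \<open>i * (1 + y^2) - 1 = 0\<close>.\<close>
      moreover have "k *\<^sub>R ((y *\<^sub>R ((y\<^sup>2 * r y * slope x - 1) *\<^sub>R \<phi> x y - (y * r y * B2 x) *\<^sub>R \<xi> x y - (y * r y * C2 x) *\<^sub>R X\<alpha> x y) + 1 *\<^sub>R X\<beta> x y)
           - - ((y\<^sup>2 * r y * slope x - 1) *\<^sub>R X\<beta> x y)) + (- (k * (y * i))) *\<^sub>R (y *\<^sub>R X\<beta> x y - \<phi> x y)
         - (y * y * k) *\<^sub>R ((r y * slope x - i) *\<^sub>R (X\<beta> x y + y *\<^sub>R \<phi> x y) - r y *\<^sub>R (B2 x *\<^sub>R \<xi> x y + C2 x *\<^sub>R X\<alpha> x y))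
         = (k * y * (i * (1 + y\<^sup>2) - 1)) *\<^sub>R \<phi> x y"
        by (simp add: algebra_simps power2_eq_square)
      moreover have "i * (1 + y\<^sup>2) = 1"
        using q[of y] by (simp add: i_def)
      ultimately show ?thesis
        by (simp only: coef) simp
    qed
    fix y
    note frame = frame_fieldD(1)[OF F x, of y]
    have u_eq: "u y = (- (1 / s y)) *\<^sub>R \<phi> x y + 0 *\<^sub>R X\<alpha> x y + (y / s y) *\<^sub>R X\<beta> x y + 0 *\<^sub>R \<xi> x y"
      by (simp add: u_def s_def algebra_simps)
    have v_eq: "v y = (s y * A y * y) *\<^sub>R \<phi> x y + (- (s y * r y * C2 x)) *\<^sub>R X\<alpha> x y
        + (s y * A y) *\<^sub>R X\<beta> x y + (- (s y * r y * B2 x)) *\<^sub>R \<xi> x y"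
      by (simp add: v_def algebra_simps)
    have "u y \<bullet> u y = (1 + y\<^sup>2) / (s y * s y)"
      unfolding u_eq inner_orthonormal_frame[OF frame] by (simp add: power2_eq_square add_divide_distrib)
    then show "norm (u y) = 1"
      using q[of y] by (simp add: norm_eq_1 ss)
    show "u y \<bullet> v y = 0"
      unfolding u_eq v_eq inner_orthonormal_frame[OF frame] by simp
    have hr: "h_fun x y * r y = 2"
      using h_fun_pos[OF x, of y] by (simp add: r_def)
    have qA: "(1 + y\<^sup>2) * A y = (1 + y\<^sup>2) * r y * slope x - 1"
      using q[of y] by (simp add: A_def right_diff_distrib)
    have "v y \<bullet> v y = s y * s y * ((1 + y\<^sup>2) * (A y)\<^sup>2 + (r y)\<^sup>2 * ((B2 x)\<^sup>2 + (C2 x)\<^sup>2))"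
      unfolding v_eq inner_orthonormal_frame[OF frame] by (simp add: power2_eq_square algebra_simps)
    also have "\<dots> = ((1 + y\<^sup>2) * A y)\<^sup>2 + (1 + y\<^sup>2) * (r y)\<^sup>2 * ((B2 x)\<^sup>2 + (C2 x)\<^sup>2)"
      unfolding ss by (simp add: power2_eq_square algebra_simps)
    \<comment> \<open>Here \<open>h_fun_mult_slope\<close> replaces the sum of the squares of
      \<open>B2\<close> and \<open>C2\<close>. The quartic terms then cancel, and
      \<open>h_fun x y * r y = 2\<close> removes the rest except 1.\<close>
    also have "\<dots> = ((1 + y\<^sup>2) * r y * slope x - 1)\<^sup>2
        + (1 + y\<^sup>2) * (r y)\<^sup>2 * (h_fun x y * slope x - (1 + y\<^sup>2) * (slope x)\<^sup>2)"
      unfolding qA h_fun_mult_slope[OF x] by simp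
    also have "\<dots> = 1 - 2 * (1 + y\<^sup>2) * r y * slope x + (1 + y\<^sup>2) * r y * slope x * (h_fun x y * r y)"
      by (simp add: power2_eq_square algebra_simps)
    finally show "norm (v y) = 1"
      by (simp add: hr norm_eq_1)
  next
    have c: "continuous_on UNIV (\<lambda>y. \<phi> x y)" "continuous_on UNIV (\<lambda>y. X\<alpha> x y)"
      "continuous_on UNIV (\<lambda>y. X\<beta> x y)" "continuous_on UNIV (\<lambda>y. \<xi> x y)"
      using frame_fieldD(6-9)[OF F x] has_vector_derivative_continuous
      by (metis continuous_at_imp_continuous_on)+
    have "continuous_on UNIV (\<lambda>y. h_fun x y)"
      unfolding h_fun_def by (intro continuous_intros)
    then have "continuous_on UNIV r"
      unfolding r_def using h_fun_pos[OF x] by (intro continuous_intros) (auto simp: less_imp_neq[symmetric])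
    then show "continuous_on UNIV v"
      unfolding v_def[abs_def] s_def A_def using q
      by (intro continuous_intros c) (auto simp: less_imp_neq[symmetric])
  qed
qed

subsection \<open>The curve \<open>ut\<close>\<close>

text \<open>
  Coordinates of \<open>x ut'(x)\<close>, computed at \<open>y = 0\<close>: along \<open>(C\<^sub>2 X\<^sub>\<alpha> + B\<^sub>2 \<xi>) / sqrt (B\<^sub>2\<^sup>2 + C\<^sub>2\<^sup>2)\<close>
  and along \<open>X\<^sub>\<beta>\<close>. They are written in \<open>slope\<close> because \<open>B2\<close> and \<open>C2\<close> have junk values at \<open>x = 0\<close>.
\<close>

definition radial_rate :: "real \<Rightarrow> real" where
  "radial_rate x = - ((X0 x + sqrt 5 / 2 + sqrt 5 * x\<^sup>2) / (2 * X0 x - x\<^sup>2 * slope x + sqrt 5))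
    + ((- (slope x / 2) - sqrt 5) * (X0 x - 5 / 4 * slope x - x\<^sup>2 * slope x) + (x * slope' x)\<^sup>2 / 2)
      / ((- (slope x / 2) - sqrt 5)\<^sup>2 + (x * slope' x)\<^sup>2)"

definition transverse_rate :: "real \<Rightarrow> real" where
  "transverse_rate x = - (2 * (X0 x + sqrt 5 / 2) * (- (slope x / 2) - sqrt 5))
    / ((2 * X0 x - x\<^sup>2 * slope x + sqrt 5) * sqrt ((- (slope x / 2) - sqrt 5)\<^sup>2 + (x * slope' x)\<^sup>2))"

text \<open>The length of \<open>x ut'(x)\<close>, that is, the speed of \<open>ut\<close> in the
  logarithmic parameter \<open>s = - ln x\<close>.\<close>

definition turning_speed :: "real \<Rightarrow> real" where
  "turning_speed x = sqrt ((radial_rate x)\<^sup>2 + (transverse_rate x)\<^sup>2)"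

text \<open>The first expression is \<open>h_fun x 0\<close> for \<open>x > 0\<close>, but
  positivity is needed at \<open>x = 0\<close> too, where the first integral still gives it. The
  second contains the square of a negative number.\<close>

lemma denominators_pos:
  "2 * X0 x - x\<^sup>2 * slope x + sqrt 5 > 0"
  "(- (slope x / 2) - sqrt 5)\<^sup>2 + (x * slope' x)\<^sup>2 > 0"
proof -
  have "0 < (slope x)\<^sup>2 + (slope x / 2 + sqrt 5)\<^sup>2 + (x * slope' x)\<^sup>2"
    using slope_pos[of x] by (intro add_pos_nonneg) auto
  then have "0 < slope x * (2 * X0 x - x\<^sup>2 * slope x + sqrt 5)"
    by (simp only: first_integral)
  then show "2 * X0 x - x\<^sup>2 * slope x + sqrt 5 > 0"
    using slope_pos[of x] by (simp add: zero_less_mult_iff)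
  have "- (slope x / 2) - sqrt 5 < 0"
    using slope_pos[of x] by (smt (verit) half_gt_zero real_sqrt_gt_0_iff)
  then show "(- (slope x / 2) - sqrt 5)\<^sup>2 + (x * slope' x)\<^sup>2 > 0"
    by (intro add_pos_nonneg) auto
qed

text \<open>A positive factor from \<open>X0_ge\<close> meets the negative expression for
  \<open>B2\<close>. Consequently \<open>ut\<close> never comes to rest.\<close>

lemma transverse_rate_pos: "transverse_rate x > 0"
proof -
  have "X0 x + sqrt 5 / 2 > 0"
    using X0_ge[of x] by (auto intro!: add_pos_pos)
  moreover have "- (slope x / 2) - sqrt 5 < 0"
    using slope_pos[of x] by (smt (verit) half_gt_zero real_sqrt_gt_0_iff)
  ultimately have "2 * (X0 x + sqrt 5 / 2) * (- (slope x / 2) - sqrt 5) < 0"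
    by (intro mult_pos_neg) auto
  then show ?thesis
    unfolding transverse_rate_def using denominators_pos[of x]
    by (intro divide_pos_pos mult_pos_pos) auto
qed

lemma turning_speed_sq_pos: "(radial_rate x)\<^sup>2 + (transverse_rate x)\<^sup>2 > 0"
  using transverse_rate_pos[of x] by (intro add_nonneg_pos) auto

lemma turning_speed_pos: "turning_speed x > 0"
  using turning_speed_sq_pos[of x] by (simp add: turning_speed_def)

text \<open>At the origin the rates are \<open>-1/2\<close> and \<open>1\<close>, whence
  \<open>sqrt (1/4 + 1)\<close>. This is the angular speed of the limit circle.\<close>

lemma turning_speed_at_zero: "turning_speed 0 = sqrt 5 / 2"
proof -
  have radial: "radial_rate 0 = - 1 / 2"
    using denominators_pos(1)[of 0] by (simp add: radial_rate_def X0_slope_at_zero field_simps)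
  have "sqrt ((- 1 - sqrt 5)\<^sup>2) = 1 + sqrt 5"
    by (rule real_sqrt_unique) (simp_all add: power2_eq_square algebra_simps)
  moreover have "5 + sqrt 5 \<noteq> 0" "1 + sqrt 5 \<noteq> 0"
    using add_pos_pos[of 5 "sqrt 5"] add_pos_pos[of 1 "sqrt 5"] by simp_all
  ultimately have "transverse_rate 0 = 1"
    by (simp add: transverse_rate_def X0_slope_at_zero field_simps)
  with radial show ?thesis
    by (simp add: turning_speed_def power2_eq_square real_sqrt_divide)
qed

lemma field_differentiable_sqrt:
  fixes f :: "real \<Rightarrow> real"
  assumes "f field_differentiable at x" "f x > 0"
  shows "(\<lambda>x. sqrt (f x)) field_differentiable at x"
  using assms DERIV_chain2[OF DERIV_real_sqrt] unfolding field_differentiable_def by blast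

lemma turning_speed_differentiable: "turning_speed field_differentiable at x"
proof -
  have d: "X0 field_differentiable at x" "slope field_differentiable at x"
    "(\<lambda>x. x * slope' x) field_differentiable at x"
    using X0_has_derivative slope_has_derivative euler_slope_derivative[of x]
    unfolding field_differentiable_def by blast+
  note p = denominators_pos[of x]
  have "radial_rate field_differentiable at x"
    unfolding radial_rate_def[abs_def] using p by (intro derivative_intros d) auto
  moreover have "transverse_rate field_differentiable at x"
    unfolding transverse_rate_def[abs_def] using p
    by (intro derivative_intros field_differentiable_sqrt d) auto
  ultimately show ?thesis
    unfolding turning_speed_def[abs_def]
    by (intro field_differentiable_sqrt derivative_intros turning_speed_sq_pos)
qed

text \<open>At \<open>y = 0\<close> the coefficient \<open>coef_a1\<close> vanishes, so
  \<open>x ut'(x)\<close> has no \<open>\<phi>\<close> component. It splits into a rotation inside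
  the plane of \<open>X\<alpha>\<close>, \<open>\<xi>\<close> and a part along
  \<open>X\<beta>\<close>.\<close>

lemma ut_derivative:
  assumes F: "frame_field \<phi> X\<alpha> X\<beta> \<xi>"
  defines "ut \<equiv> \<lambda>x. (1 / sqrt ((B2 x)\<^sup>2 + (C2 x)\<^sup>2)) *\<^sub>R (- (B2 x *\<^sub>R X\<alpha> x 0) + C2 x *\<^sub>R \<xi> x 0)"
  obtains v where "\<And>x. x > 0 \<Longrightarrow> (ut has_vector_derivative (turning_speed x / x) *\<^sub>R v x) (at x)"
    "\<And>x. x > 0 \<Longrightarrow> norm (ut x) = 1" "\<And>x. x > 0 \<Longrightarrow> norm (v x) = 1" "\<And>x. x > 0 \<Longrightarrow> ut x \<bullet> v x = 0"
    "continuous_on {0<..} v"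
proof -
  define b where "b x = - (slope x / 2) - sqrt 5" for x
  define c where "c x = x * slope' x" for x
  define h0 where "h0 x = 2 * X0 x - x\<^sup>2 * slope x + sqrt 5" for x
  define n where "n x = 1 / sqrt ((b x)\<^sup>2 + (c x)\<^sup>2)" for x
  define v where "v x = (1 / turning_speed x) *\<^sub>R
    (radial_rate x *\<^sub>R (n x *\<^sub>R (c x *\<^sub>R X\<alpha> x 0 + b x *\<^sub>R \<xi> x 0)) + transverse_rate x *\<^sub>R X\<beta> x 0)" for x
  have h0: "h0 x > 0" and N: "(b x)\<^sup>2 + (c x)\<^sup>2 > 0" for x
    using denominators_pos[of x] by (auto simp: b_def c_def h0_def)
  have nn: "n x * n x * ((b x)\<^sup>2 + (c x)\<^sup>2) = 1" for x
    using N[of x] by (simp add: n_def less_imp_neq[symmetric] del: sum_power2_eq_zero_iff)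
  have ut: "ut x = n x *\<^sub>R (- (b x *\<^sub>R X\<alpha> x 0) + c x *\<^sub>R \<xi> x 0)" if "x > 0" for x
    using that by (simp add: ut_def n_def b_def c_def B2_eq C2_eq)
  show thesis
  proof
    fix x :: real
    assume x: "x > 0"
    note frame = frame_fieldD(1)[OF F x, of 0]
    have ut_eq: "ut x = 0 *\<^sub>R \<phi> x 0 + (- (n x * b x)) *\<^sub>R X\<alpha> x 0 + 0 *\<^sub>R X\<beta> x 0 + (n x * c x) *\<^sub>R \<xi> x 0"
      by (simp add: ut[OF x] algebra_simps)
    have v_eq: "v x = 0 *\<^sub>R \<phi> x 0 + (radial_rate x * n x * c x / turning_speed x) *\<^sub>R X\<alpha> x 0
      + (transverse_rate x / turning_speed x) *\<^sub>R X\<beta> x 0 + (radial_rate x * n x * b x / turning_speed x) *\<^sub>R \<xi> x 0"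
      by (simp add: v_def algebra_simps)
    have "ut x \<bullet> ut x = n x * n x * ((b x)\<^sup>2 + (c x)\<^sup>2)"
      unfolding ut_eq inner_orthonormal_frame[OF frame] by (simp add: power2_eq_square algebra_simps)
    then show "norm (ut x) = 1"
      by (simp add: norm_eq_1 nn)
    show "ut x \<bullet> v x = 0"
      unfolding ut_eq v_eq inner_orthonormal_frame[OF frame] by simp
    have "v x \<bullet> v x = ((radial_rate x)\<^sup>2 * (n x * n x * ((b x)\<^sup>2 + (c x)\<^sup>2)) + (transverse_rate x)\<^sup>2) / (turning_speed x)\<^sup>2"
      unfolding v_eq inner_orthonormal_frame[OF frame]
      by (simp add: power2_eq_square add_divide_distrib algebra_simps)
    also have "\<dots> = 1"
      using turning_speed_sq_pos[of x]
      by (simp add: nn turning_speed_def less_imp_neq[symmetric] del: sum_power2_eq_zero_iff)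
    finally show "norm (v x) = 1"
      by (simp add: norm_eq_1)
    obtain d where d: "(c has_real_derivative d) (at x)" "x * d = X0 x - 5 / 4 * slope x - x\<^sup>2 * slope x"
      using euler_slope_derivative[of x] by (auto simp: c_def[abs_def])
    define b' where "b' = - (slope' x / 2)"
    define M where "M = 1 / ((b x)\<^sup>2 + (c x)\<^sup>2)"
    have M: "((b x)\<^sup>2 + (c x)\<^sup>2) * M = 1"
      using N[of x] by (simp add: M_def less_imp_neq[symmetric] del: sum_power2_eq_zero_iff)
    have b': "(b has_real_derivative b') (at x)"
      unfolding b_def b'_def by (auto intro!: derivative_eq_intros slope_has_derivative)
    have n': "(n has_real_derivative - ((b x * b' + c x * d) * M * n x)) (at x)"
    proof -
      define R where "R x = (b x)\<^sup>2 + (c x)\<^sup>2" for x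
      have R: "R x > 0" "M = 1 / R x"
        using N[of x] by (auto simp: R_def M_def)
      have R': "(R has_real_derivative 2 * (b x * b' + c x * d)) (at x)"
        unfolding R_def by (auto intro!: derivative_eq_intros b' d(1) simp: algebra_simps)
      have "((\<lambda>x. 1 / sqrt (R x)) has_real_derivative
          - ((b x * b' + c x * d) / sqrt (R x)) / (sqrt (R x) * sqrt (R x))) (at x)"
        using R by (auto intro!: derivative_eq_intros R' simp: field_simps)
      moreover have "- ((b x * b' + c x * d) / sqrt (R x)) / (sqrt (R x) * sqrt (R x))
          = - ((b x * b' + c x * d) * M * (1 / sqrt (R x)))"
        using R by simp
      ultimately show ?thesis
        unfolding n_def R_def by simp
    qed
    have "((\<lambda>x. n x *\<^sub>R (- (b x *\<^sub>R X\<alpha> x 0) + c x *\<^sub>R \<xi> x 0)) has_vector_derivative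
        n x *\<^sub>R (- (b x *\<^sub>R (coef_a1 x 0 *\<^sub>R \<phi> x 0 - coef_b1 x 0 *\<^sub>R \<xi> x 0 - coef_c1 x 0 *\<^sub>R X\<beta> x 0) + b' *\<^sub>R X\<alpha> x 0)
          + (c x *\<^sub>R (coef_b1 x 0 *\<^sub>R X\<alpha> x 0) + d *\<^sub>R \<xi> x 0))
        + (- ((b x * b' + c x * d) * M * n x)) *\<^sub>R (- (b x *\<^sub>R X\<alpha> x 0) + c x *\<^sub>R \<xi> x 0)) (at x)"
      by (intro has_vector_derivative_scaleR has_vector_derivative_add has_vector_derivative_minus
          n' b' d(1) frame_fieldD[OF F x])
    moreover have "coef_a1 x 0 = 0"
      by (simp add: coef_a1_def)
    \<comment> \<open>The turning \<open>coef_b1\<close> of the frame plus the angular velocity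
      \<open>(b c' - b' c) / (b^2 + c^2)\<close> of the coordinate pair
      \<open>(b, c)\<close>.\<close>
    moreover have radial: "radial_rate x / x = coef_b1 x 0 + (b x * d - b' * c x) * M"
    proof -
      have "radial_rate x = - ((X0 x + sqrt 5 / 2 + sqrt 5 * x\<^sup>2) / h0 x) + (b x * (x * d) + (c x)\<^sup>2 / 2) * M"
        unfolding radial_rate_def d(2) by (simp add: h0_def b_def c_def M_def)
      also have "(b x * (x * d) + (c x)\<^sup>2 / 2) * M = x * ((b x * d - b' * c x) * M)"
        by (simp add: b'_def c_def power2_eq_square algebra_simps)
      also have "- ((X0 x + sqrt 5 / 2 + sqrt 5 * x\<^sup>2) / h0 x) = x * coef_b1 x 0"
        using x by (simp add: coef_b1_def h_fun_eq h0_def)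
      finally show ?thesis
        using x by (simp add: field_simps)
    qed
    have transverse: "transverse_rate x / x = n x * b x * coef_c1 x 0"
    proof -
      have "transverse_rate x = - (2 * (X0 x + sqrt 5 / 2) / h0 x * b x * n x)"
        unfolding transverse_rate_def n_def h0_def[symmetric] b_def[symmetric] c_def[symmetric]
        by simp
      moreover have "coef_c1 x 0 = - (2 * (X0 x + sqrt 5 / 2) / h0 x) / x"
        using x by (simp add: coef_c1_def h_fun_eq h0_def)
      ultimately show ?thesis
        by simp
    qed
    have v: "(turning_speed x / x) *\<^sub>R v x = (radial_rate x / x) *\<^sub>R (n x *\<^sub>R (c x *\<^sub>R X\<alpha> x 0 + b x *\<^sub>R \<xi> x 0))
        + (transverse_rate x / x) *\<^sub>R X\<beta> x 0"
      using turning_speed_pos[of x] by (simp add: v_def scaleR_add_right)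
    \<comment> \<open>Again a polynomial identity with \<open>M\<close> as a symbol: each remaining
      term has the factor \<open>(b^2 + c^2) M - 1\<close>, up to sign.\<close>
    have "n x *\<^sub>R (- (b x *\<^sub>R (0 *\<^sub>R \<phi> x 0 - coef_b1 x 0 *\<^sub>R \<xi> x 0 - coef_c1 x 0 *\<^sub>R X\<beta> x 0) + b' *\<^sub>R X\<alpha> x 0)
          + (c x *\<^sub>R (coef_b1 x 0 *\<^sub>R X\<alpha> x 0) + d *\<^sub>R \<xi> x 0))
        + (- ((b x * b' + c x * d) * M * n x)) *\<^sub>R (- (b x *\<^sub>R X\<alpha> x 0) + c x *\<^sub>R \<xi> x 0)
        - (turning_speed x / x) *\<^sub>R v x
        = (n x * b' * (((b x)\<^sup>2 + (c x)\<^sup>2) * M - 1)) *\<^sub>R X\<alpha> x 0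
          + (n x * d * (1 - ((b x)\<^sup>2 + (c x)\<^sup>2) * M)) *\<^sub>R \<xi> x 0"
      unfolding v radial transverse by (simp add: algebra_simps power2_eq_square)
    ultimately have "((\<lambda>x. n x *\<^sub>R (- (b x *\<^sub>R X\<alpha> x 0) + c x *\<^sub>R \<xi> x 0)) has_vector_derivative
        (turning_speed x / x) *\<^sub>R v x) (at x)"
      by (simp only: M) simp
    then show "(ut has_vector_derivative (turning_speed x / x) *\<^sub>R v x) (at x)"
      by (rule has_vector_derivative_transform_within_open[of _ _ _ "{0<..}"]) (auto simp: x ut)
  next
    have c': "continuous_on {0<..} (\<lambda>x. X\<alpha> x 0)" "continuous_on {0<..} (\<lambda>x. X\<beta> x 0)" "continuous_on {0<..} (\<lambda>x. \<xi> x 0)"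
      using frame_fieldD(3-5)[OF F] has_vector_derivative_continuous
      by (metis continuous_at_imp_continuous_on greaterThan_iff)+
    have diff: "continuous_on UNIV X0" "continuous_on UNIV slope" "continuous_on UNIV c" "continuous_on UNIV turning_speed"
      using X0_has_derivative slope_has_derivative euler_slope_derivative turning_speed_differentiable
      unfolding c_def[abs_def]
      by (metis DERIV_isCont continuous_at_imp_continuous_on field_differentiable_imp_continuous_at)+
    note cont = continuous_on_subset[OF diff(1) subset_UNIV] continuous_on_subset[OF diff(2) subset_UNIV]
      continuous_on_subset[OF diff(3) subset_UNIV] continuous_on_subset[OF diff(4) subset_UNIV]
    have b: "continuous_on {0<..} b"
      unfolding b_def by (intro continuous_intros cont) auto
    have h: "continuous_on {0<..} h0"
      unfolding h0_def by (intro continuous_intros cont)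
    have nz1: "sqrt ((b x)\<^sup>2 + (c x)\<^sup>2) \<noteq> 0" for x
      using N[of x] by (simp only: real_sqrt_eq_0_iff)
    have nz2: "(b x)\<^sup>2 + (c x)\<^sup>2 \<noteq> 0" "h0 x \<noteq> 0" for x
      using N[of x] h0[of x] by (simp_all only: less_irrefl simp_thms less_imp_neq[symmetric])
    have nz3: "turning_speed x \<noteq> 0" for x
      using turning_speed_pos[of x] by simp
    note nz = nz1 nz2 nz3
    have n: "continuous_on {0<..} n"
      unfolding n_def by (intro continuous_intros cont b ballI nz)
    have "continuous_on {0<..} radial_rate"
      unfolding radial_rate_def[abs_def] c_def[symmetric] b_def[symmetric] h0_def[symmetric]
      by (intro continuous_intros cont b h ballI nz) auto
    moreover have "continuous_on {0<..} transverse_rate"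
      unfolding transverse_rate_def[abs_def] c_def[symmetric] b_def[symmetric] h0_def[symmetric]
      by (intro continuous_intros cont b h ballI no_zero_divisors nz) auto
    ultimately show "continuous_on {0<..} v"
      unfolding v_def by (intro continuous_intros cont b n c' ballI nz)
  qed
qed

subsection \<open>Limit circles\<close>

text \<open>Differentiability at 0 extends the quotient continuously by the derivative
  \<open>D\<close>, so it has an antiderivative on the whole real axis. Along
  \<open>x = exp (- s)\<close> this \<open>Q\<close> measures how far the phase deviates from
  uniform rotation.\<close>

lemma antiderivative_of_difference_quotient:
  fixes T :: "real \<Rightarrow> real"
  assumes "\<And>x. T field_differentiable at x"
  obtains Q where "\<And>x. x \<noteq> 0 \<Longrightarrow> (Q has_real_derivative (T x - T 0) / x) (at x)" "isCont Q 0"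
proof -
  obtain D where D: "(T has_real_derivative D) (at 0)"
    using assms[of 0] by (auto simp: field_differentiable_def)
  define q where "q x = (if x = 0 then D else (T x - T 0) / x)" for x
  have "isCont q x" for x
  proof (cases "x = 0")
    case True
    have "((\<lambda>x. (T x - T 0) / x) \<longlongrightarrow> D) (at 0)"
      using D by (simp add: has_field_derivative_iff)
    then have "(q \<longlongrightarrow> D) (at 0)"
      by (rule Lim_transform_eventually) (auto simp: q_def eventually_at_filter)
    then show ?thesis
      by (simp add: True isCont_def q_def)
  next
    case False
    have "isCont (\<lambda>x. (T x - T 0) / x) x"
      using False field_differentiable_imp_continuous_at[OF assms] by (intro continuous_intros) auto
    moreover have "\<forall>\<^sub>F z in nhds x. (T z - T 0) / z = q z"
      using t1_space_nhds[OF False] by eventually_elim (simp add: q_def)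
    ultimately show ?thesis
      using isCont_cong[of "\<lambda>x. (T x - T 0) / x" q x] by blast
  qed
  then obtain Q where Q: "\<And>x. (Q has_vector_derivative q x) (at x)"
    using einterval_antiderivative[of "-\<infinity>" \<infinity> q] by auto
  show thesis
  proof
    show "(Q has_real_derivative (T x - T 0) / x) (at x)" if "x \<noteq> 0" for x
      using Q[of x] that by (simp add: has_real_derivative_iff_has_vector_derivative q_def)
    show "isCont Q 0"
      using Q has_vector_derivative_continuous by blast
  qed
qed

theorem theorem3:
  fixes f \<phi> X\<alpha> X\<beta> \<xi> :: "real \<Rightarrow> real \<Rightarrow> real ^ 4"
  assumes "curvature_surface f \<phi> X\<alpha> X\<beta> \<xi>"
  shows "\<exists>(u :: real \<Rightarrow> real ^ 4) (ut :: real \<Rightarrow> real ^ 4).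
    (\<forall>x>0. \<forall>y. u y = (1 / sqrt (1 + y\<^sup>2)) *\<^sub>R (y *\<^sub>R X\<beta> x y - \<phi> x y)) \<and>
    (\<forall>x>0. \<forall>y. ut x = (1 / sqrt ((B2 x)\<^sup>2 + (C2 x)\<^sup>2)) *\<^sub>R (- (B2 x *\<^sub>R X\<alpha> x y) + C2 x *\<^sub>R \<xi> x y)) \<and>
    (\<forall>y. norm (u y) = 1) \<and> (\<forall>x>0. norm (ut x) = 1) \<and>
    (\<exists>b c bt ct. orthonormal_frame [b, c, bt, ct] \<and>
      (\<forall>y. u y \<in> unit_circle bt ct) \<and>
      (\<exists>v. unit_velocity_y u v \<and> (\<forall>w. unit_velocity_y u w \<longrightarrow> w = v) \<and>
        uniformly_converges_to u (\<lambda>y. cos y *\<^sub>R bt + sin y *\<^sub>R ct) \<and>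
        uniformly_converges_to v (\<lambda>y. - (sin y *\<^sub>R bt) + cos y *\<^sub>R ct)) \<and>
      (\<forall>x>0. ut x \<in> unit_circle b c) \<and>
      (\<exists>T vt. unit_velocity_x ut T vt \<and>
        (\<forall>S w. unit_velocity_x ut S w \<longrightarrow> S = T \<and> (\<forall>x>0. w x = vt x)) \<and>
        uniformly_converges_to (\<lambda>s. ut (exp (- s)))
          (\<lambda>s. cos (sqrt 5 * s / 2) *\<^sub>R b - sin (sqrt 5 * s / 2) *\<^sub>R c) \<and>
        uniformly_converges_to (\<lambda>s. vt (exp (- s)))
          (\<lambda>s. sin (sqrt 5 * s / 2) *\<^sub>R b + cos (sqrt 5 * s / 2) *\<^sub>R c)))"
proof -
  have F: "frame_field \<phi> X\<alpha> X\<beta> \<xi>"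
    using assms by (simp add: curvature_surface_def)
  define u where "u y = (1 / sqrt (1 + y\<^sup>2)) *\<^sub>R (y *\<^sub>R X\<beta> 1 y - \<phi> 1 y)" for y
  define ut where "ut x = (1 / sqrt ((B2 x)\<^sup>2 + (C2 x)\<^sup>2)) *\<^sub>R (- (B2 x *\<^sub>R X\<alpha> x 0) + C2 x *\<^sub>R \<xi> x 0)" for x
  obtain v where v: "\<And>y. (u has_vector_derivative (y\<^sup>2 / (1 + y\<^sup>2)) *\<^sub>R v y) (at y)"
    "\<And>y. norm (u y) = 1" "\<And>y. norm (v y) = 1" "\<And>y. u y \<bullet> v y = 0" "continuous_on UNIV v"
    by (rule u_derivative[OF F, of 1, folded u_def]) auto
  obtain vt where vt: "\<And>x. x > 0 \<Longrightarrow> (ut has_vector_derivative (turning_speed x / x) *\<^sub>R vt x) (at x)"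
    "\<And>x. x > 0 \<Longrightarrow> norm (ut x) = 1" "\<And>x. x > 0 \<Longrightarrow> norm (vt x) = 1" "\<And>x. x > 0 \<Longrightarrow> ut x \<bullet> vt x = 0"
    "continuous_on {0<..} vt"
    by (rule ut_derivative[OF F, folded ut_def]) auto
  have u: "u y = (1 / sqrt (1 + y\<^sup>2)) *\<^sub>R (y *\<^sub>R X\<beta> x y - \<phi> x y)" if "x > 0" for x y
    using u_independent_of_x[OF F that, of 1] by (simp add: u_def)
  have ut: "ut x = (1 / sqrt ((B2 x)\<^sup>2 + (C2 x)\<^sup>2)) *\<^sub>R (- (B2 x *\<^sub>R X\<alpha> x y) + C2 x *\<^sub>R \<xi> x y)" if "x > 0" for x y
    using ut_independent_of_y[OF F that, of 0 y] by (simp add: ut_def)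
  have q: "y\<^sup>2 / (1 + y\<^sup>2) \<noteq> 0" if "y \<noteq> 0" for y :: real
    using that by (simp add: add_nonneg_eq_0_iff)

  \<comment> \<open>Orthogonality of the curves and their velocities\<close>
  have u_ut: "u y \<bullet> ut x = 0" if "x > 0" for x y
    using frame_fieldD(1)[OF F that, of y] unfolding u[OF that] ut[OF that, of y] orthonormal_frame_iff
    by (simp add: inner_diff_left inner_diff_right inner_add_right inner_commute)
  have u_vt: "u y \<bullet> vt x = 0" if x: "x > 0" for x y
  proof -
    have "((\<lambda>x. u y \<bullet> ut x) has_vector_derivative u y \<bullet> ((turning_speed x / x) *\<^sub>R vt x)) (at x)"
      by (rule bounded_linear.has_vector_derivative[OF bounded_linear_inner_right vt(1)[OF x]])
    moreover have "((\<lambda>x. u y \<bullet> ut x) has_vector_derivative 0) (at x)"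
      by (rule has_vector_derivative_transform_within_open[of "\<lambda>_. 0" _ _ "{0<..}"]) (auto simp: x u_ut)
    ultimately have "u y \<bullet> ((turning_speed x / x) *\<^sub>R vt x) = 0"
      by (rule vector_derivative_unique_at)
    then show ?thesis
      using turning_speed_pos[of x] x by simp
  qed
  \<comment> \<open>Differentiating \<open>u y \<bullet> w = 0\<close> gives this where the speed is
    nonzero; continuity of \<open>v\<close> adds \<open>y = 0\<close>.\<close>
  have perp_v: "v y \<bullet> w = 0" if "\<And>y. u y \<bullet> w = 0" for w y
  proof -
    have "v y \<bullet> w = 0" if "y \<noteq> 0" for y
    proof -
      have "((\<lambda>y. u y \<bullet> w) has_vector_derivative ((y\<^sup>2 / (1 + y\<^sup>2)) *\<^sub>R v y) \<bullet> w) (at y)"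
        by (rule bounded_linear.has_vector_derivative[OF bounded_linear_inner_left v(1)])
      moreover have "((\<lambda>y. u y \<bullet> w) has_vector_derivative 0) (at y)"
        by (simp add: \<open>\<And>y. u y \<bullet> w = 0\<close>)
      ultimately have "((y\<^sup>2 / (1 + y\<^sup>2)) *\<^sub>R v y) \<bullet> w = 0"
        by (rule vector_derivative_unique_at)
      then show ?thesis
        using q[OF that] by (simp only: inner_scaleR_left mult_eq_0_iff) simp
    qed
    moreover have "continuous_on UNIV (\<lambda>y. v y \<bullet> w)"
      by (intro continuous_intros v(5))
    ultimately have "(\<lambda>y. v y \<bullet> w) = (\<lambda>y. 0)"
      by (intro eq_if_eq_off_zero) auto
    then show ?thesis
      by metis
  qed
  have v_ut: "v y \<bullet> ut x = 0" and v_vt: "v y \<bullet> vt x = 0" if "x > 0" for x y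
    using perp_v u_ut[OF that] u_vt[OF that] by blast+
  note perp = u_ut u_vt v_ut v_vt
  have perp': "ut x \<bullet> u y = 0" "vt x \<bullet> u y = 0" "ut x \<bullet> v y = 0" "vt x \<bullet> v y = 0" if "x > 0" for x y
    using perp[OF that, of y] by (simp_all add: inner_commute)
  \<comment> \<open>Two orderings, because \<open>orthonormal_frame_expand\<close> expands in the
    last two vectors.\<close>
  have frame: "orthonormal_frame [ut 1, vt 1, u 1, v 1]" "orthonormal_frame [u 1, v 1, ut 1, vt 1]"
    unfolding orthonormal_frame_iff by (simp_all add: v vt perp perp')
  \<comment> \<open>The constant \<open>pi / 2\<close> is the limit of \<open>arctan\<close>; with
    it the angle minus \<open>y\<close> tends to 0, so the limit circle has no phase shift.\<close>
  have angle: "((\<lambda>y. y - arctan y + pi / 2) has_real_derivative y\<^sup>2 / (1 + y\<^sup>2)) (at y)" for y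
    using add_nonneg_pos[of "y\<^sup>2" 1]
    by (auto intro!: derivative_eq_intros simp: field_simps add_nonneg_eq_0_iff)
  have plane: "u y = (u y \<bullet> u 1) *\<^sub>R u 1 + (u y \<bullet> v 1) *\<^sub>R v 1"
    "v y = (v y \<bullet> u 1) *\<^sub>R u 1 + (v y \<bullet> v 1) *\<^sub>R v 1" for y
    by (rule orthonormal_frame_expand[OF frame(1)]; simp add: perp)+
  obtain bt ct where bct: "norm bt = 1" "norm ct = 1" "bt \<bullet> ct = 0"
    "bt \<in> span {u 1, v 1}" "ct \<in> span {u 1, v 1}"
    and u_eq: "\<And>y. u y = cos (y - arctan y + pi / 2) *\<^sub>R bt + sin (y - arctan y + pi / 2) *\<^sub>R ct"
    and v_eq: "\<And>y. v y = - (sin (y - arctan y + pi / 2) *\<^sub>R bt) + cos (y - arctan y + pi / 2) *\<^sub>R ct"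
    by (rule planar_rotation[OF v(1) angle v(5) v(2,3,4) v(2,3,4) plane]) blast
  have "((\<lambda>y. pi / 2 - arctan y) \<longlongrightarrow> pi / 2 - pi / 2) at_top"
    by (intro tendsto_intros tendsto_arctan_at_top)
  then have lim_y: "((\<lambda>y. (y - arctan y + pi / 2) - y) \<longlongrightarrow> 0) at_top"
    by (simp add: algebra_simps)
  obtain Q where Q: "\<And>x. x \<noteq> 0 \<Longrightarrow> (Q has_real_derivative (turning_speed x - sqrt 5 / 2) / x) (at x)" "isCont Q 0"
    using antiderivative_of_difference_quotient[OF turning_speed_differentiable] unfolding turning_speed_at_zero by blast
  \<comment> \<open>Subtracting \<open>Q 0\<close> normalises the phase: \<open>exp (- s)\<close>
    tends to 0 and \<open>Q\<close> is continuous there, so \<open>G s\<close> approaches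
    \<open>- (sqrt 5 * s / 2)\<close>.\<close>
  define G where "G s = Q (exp (- s)) - Q 0 - sqrt 5 * s / 2" for s
  define T where "T s = turning_speed (exp (- s))" for s
  have exp': "((\<lambda>s. exp (- s)) has_real_derivative - exp (- s)) (at s)" for s :: real
    by (auto intro!: derivative_eq_intros)
  have G': "(G has_real_derivative - T s) (at s)" for s
  proof -
    have "((\<lambda>s. Q (exp (- s))) has_real_derivative (T s - sqrt 5 / 2) / exp (- s) * - exp (- s)) (at s)"
      unfolding T_def by (rule DERIV_chain2[OF Q(1) exp']) simp
    then have "((\<lambda>s. Q (exp (- s))) has_real_derivative sqrt 5 / 2 - T s) (at s)"
      by simp
    then show ?thesis
      unfolding G_def by (auto intro!: derivative_eq_intros)
  qed
  \<comment> \<open>The inner derivative \<open>- exp (- s)\<close> cancels the \<open>1 / x\<close>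
    in the speed and leaves the minus sign: \<open>vt\<close> points in the direction of increasing
    \<open>x\<close>, while \<open>s\<close> runs towards \<open>x = 0\<close>.\<close>
  have W': "((\<lambda>s. ut (exp (- s))) has_vector_derivative - T s *\<^sub>R vt (exp (- s))) (at s)" for s
    using vector_diff_chain_at[OF exp'[unfolded has_real_derivative_iff_has_vector_derivative] vt(1)[OF exp_gt_zero], of s]
    by (simp add: o_def T_def)
  have cont: "continuous_on UNIV (\<lambda>s. vt (exp (- s)))"
    by (intro continuous_on_compose2[OF vt(5)] continuous_intros) auto
  have plane': "ut x = (ut x \<bullet> ut 1) *\<^sub>R ut 1 + (ut x \<bullet> vt 1) *\<^sub>R vt 1"
    "vt x = (vt x \<bullet> ut 1) *\<^sub>R ut 1 + (vt x \<bullet> vt 1) *\<^sub>R vt 1" if "x > 0" for x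
    by (rule orthonormal_frame_expand[OF frame(2)]; simp add: perp' that)+
  obtain b c where bc: "norm b = 1" "norm c = 1" "b \<bullet> c = 0"
    "b \<in> span {ut 1, vt 1}" "c \<in> span {ut 1, vt 1}"
    and ut_eq: "\<And>s. ut (exp (- s)) = cos (G s) *\<^sub>R b + sin (G s) *\<^sub>R c"
    and vt_eq: "\<And>s. vt (exp (- s)) = - (sin (G s) *\<^sub>R b) + cos (G s) *\<^sub>R c"
    by (rule planar_rotation[OF W' G' cont vt(2-4)[OF exp_gt_zero] vt(2-4)[OF zero_less_one]
          plane'[OF exp_gt_zero]]) blast
  have "((\<lambda>s. Q (exp (- s)) - Q 0) \<longlongrightarrow> Q 0 - Q 0) at_top"
    by (intro tendsto_intros isCont_tendsto_compose[OF Q(2)] filterlim_compose[OF exp_at_bot] filterlim_uminus_at_bot_at_top)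
  then have lim_s: "((\<lambda>s. G s - - (sqrt 5 * s / 2)) \<longlongrightarrow> 0) at_top"
    by (simp add: G_def)

  \<comment> \<open>Uniqueness of the unit velocities\<close>
  have vel_y: "unit_velocity_y u v"
    using v by (simp add: unit_velocity_y_def)
  have uniq_y: "w = v" if "unit_velocity_y u w" for w
  proof (rule eq_if_eq_off_zero)
    show "continuous_on UNIV w" "continuous_on UNIV v"
      using that v(5) by (auto simp: unit_velocity_y_def)
    fix y :: real
    assume "y \<noteq> 0"
    have "(y\<^sup>2 / (1 + y\<^sup>2)) *\<^sub>R w y = (y\<^sup>2 / (1 + y\<^sup>2)) *\<^sub>R v y"
      using that v(1) vector_derivative_unique_at unfolding unit_velocity_y_def by blast
    then show "w y = v y"
      using q[OF \<open>y \<noteq> 0\<close>] by (simp only: scaleR_cancel_left) simp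
  qed
  have vel_x: "unit_velocity_x ut T vt"
    using W' vt(3) turning_speed_pos by (simp add: unit_velocity_x_def T_def)
  have uniq_x: "S = T \<and> (\<forall>x>0. w x = vt x)" if "unit_velocity_x ut S w" for S w
  proof -
    have eq: "S s *\<^sub>R w (exp (- s)) = T s *\<^sub>R vt (exp (- s))" for s
      using that vel_x vector_derivative_unique_at unfolding unit_velocity_x_def by (metis neg_equal_iff_equal)
    have pos: "S s > 0" "T s > 0" "norm (w (exp (- s))) = 1" "norm (vt (exp (- s))) = 1" for s
      using that vel_x by (auto simp: unit_velocity_x_def)
    \<comment> \<open>Both speeds are positive and both directions are unit vectors, so taking norms
      separates speed from direction.\<close>
    have "S s = T s" for s
      using arg_cong[OF eq[of s], of norm] pos[of s] by simp
    moreover from this have "w (exp (- s)) = vt (exp (- s))" for s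
      using eq[of s] pos(2)[of s] by simp
    then have "w x = vt x" if "x > 0" for x
      using that by (metis exp_ln minus_minus)
    ultimately show ?thesis
      by blast
  qed

  \<comment> \<open>The common frame and the limit circles\<close>
  have "orthogonal p q'" if "p \<in> span {ut 1, vt 1}" "q' \<in> span {u 1, v 1}" for p q'
  proof (rule orthogonal_to_span[OF that(2)])
    fix z
    assume z: "z \<in> {u 1, v 1}"
    have "orthogonal z p"
      by (rule orthogonal_to_span[OF that(1)]) (use z perp in \<open>auto simp: orthogonal_def\<close>)
    then show "orthogonal p z"
      by (simp add: orthogonal_commute)
  qed
  then have "orthonormal_frame [b, c, bt, ct]"
    using bc bct by (simp add: orthonormal_frame_iff orthogonal_def)
  moreover have "u y \<in> unit_circle bt ct" for y
  proof -
    have "u y \<in> span {bt, ct}"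
      unfolding u_eq by (intro span_add span_scale span_base) auto
    then show ?thesis
      using v(2) by (simp add: unit_circle_def)
  qed
  moreover have "ut x \<in> unit_circle b c" if "x > 0" for x
  proof -
    have "ut x = cos (G (- ln x)) *\<^sub>R b + sin (G (- ln x)) *\<^sub>R c"
      using ut_eq[of "- ln x"] that by simp
    then have "ut x \<in> span {b, c}"
      by (simp only:) (intro span_add span_scale span_base; simp)
    then show ?thesis
      using vt(2)[OF that] by (simp add: unit_circle_def)
  qed
  moreover have "uniformly_converges_to u (\<lambda>y. cos y *\<^sub>R bt + sin y *\<^sub>R ct)"
    using uniformly_converges_to_circle[OF lim_y, of bt ct] by (simp only: u_eq[symmetric])
  \<comment> \<open>The velocity is the same kind of circle with the pair \<open>bt\<close>,
    \<open>ct\<close> replaced by \<open>ct\<close>, \<open>- bt\<close>.\<close>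
  moreover have "uniformly_converges_to v (\<lambda>y. - (sin y *\<^sub>R bt) + cos y *\<^sub>R ct)"
    using uniformly_converges_to_circle[OF lim_y, of ct "- bt"] by (simp add: v_eq[abs_def] algebra_simps)
  moreover have "uniformly_converges_to (\<lambda>s. ut (exp (- s)))
      (\<lambda>s. cos (sqrt 5 * s / 2) *\<^sub>R b - sin (sqrt 5 * s / 2) *\<^sub>R c)"
    using uniformly_converges_to_circle[OF lim_s, of b c] by (simp add: ut_eq)
  moreover have "uniformly_converges_to (\<lambda>s. vt (exp (- s)))
      (\<lambda>s. sin (sqrt 5 * s / 2) *\<^sub>R b + cos (sqrt 5 * s / 2) *\<^sub>R c)"
    using uniformly_converges_to_circle[OF lim_s, of c "- b"] by (simp add: vt_eq algebra_simps)
  ultimately show ?thesis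
    using u ut v(2) vt(2) vel_y uniq_y vel_x uniq_x by blast
qed

end
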